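(* Let $a\ge1$ and $\frac1a+\frac1b=1$. Let $g:\mathbb{R}^n\to\mathbb{R}$ be Lipschitz with respect to $\|\cdot\|_a$ with Lipschitz constant $K$, and with decomposition $g(\mathbf{x})=\tilde g(\mathbf{x}^{(1)})+\boldsymbol\beta^T\mathbf{x}^{(2)}$, where $\mathbf{x}=(\mathbf{x}^{(1)},\mathbf{x}^{(2)})$, $\mathbf{x}^{(1)}\in\mathbb{R}^m$, $\mathbf{x}^{(2)}\in\mathbb{R}^{n-m}$, $m\le n$, $\boldsymbol\beta\in\mathbb{R}^{n-m}$, and $\tilde g:\mathbb{R}^m\to\mathbb{R}$ is Lipschitz with Lipschitz constant $L$. Let $\mathbf{X}\in\mathcal{L}^p_n$ with $g(\mathbf{X})\in\mathcal{L}^p$, $\epsilon\ge0$, and let $\rho:\mathcal{L}^p\to\mathbb{R}$ be a law-invariant risk functional. Then $$\sup_{Y\in\mathcal{U}_{\|\boldsymbol\beta\|_b\epsilon}(g(\mathbf{X}))}\rho(Y)\;\le\;\sup_{\mathbf{Y}\in\mathcal{U}^n_\epsilon(\mathbf{X})}\rho\big(g(\mathbf{Y})\big)\;\le\;\sup_{Y\in\mathcal{U}_{K\epsilon}(g(\mathbf{X}))}\rho(Y).$$ Moreover, if $a=1$ and $\|\boldsymbol\beta\|_\infty\ge L$, or if $a\ge1$ and $m=0$, then the inequalities become equalities.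
   Context: Fix $p\ge 1$ and a non-atomic probability space $(\Omega,\mathcal{B},\mathbb{P})$ with $\mathcal{B}=\mathcal{B}(\mathbb{R}^n)$; all random variables/vectors live on it. $\|\mathbf{x}\|_a=(\sum_i|x_i|^a)^{1/a}$; $b=\infty$ (max norm) when $a=1$. $\mathcal{L}^p_n$ is the space of $n$-dimensional random vectors $\mathbf{X}$ with $\mathbb{E}[\|\mathbf{X}\|_a^p]<\infty$, and $\mathcal{L}^p=\mathcal{L}^p_1$. $F_{\mathbf{X}}$ is the cdf of $\mathbf{X}$. For cdfs $F,G$ on $\mathbb{R}^n$ with finite $p$-th moments, $W^n(F,G)=\inf (\mathbb{E}[\|\mathbf{X}-\mathbf{Y}\|_a^p])^{1/p}$, the infimum over all couplings $(\mathbf{X},\mathbf{Y})$ with $F_{\mathbf{X}}=F$, $F_{\mathbf{Y}}=G$. The Wasserstein uncertainty set is $\mathcal{U}^n_\epsilon(\mathbf{X})=\{\mathbf{Z}\in\mathcal{L}^p_n : W^n(F_{\mathbf{Z}},F_{\mathbf{X}})\le\epsilon\}$, with $\mathcal{U}_\epsilon=\mathcal{U}^1_\epsilon$ for univariate random variables. $\rho$ is law invariant if $\rho(X)=\rho(Y)$ whenever $X$ and $Y$ have the same distribution. The Lipschitz constant of a function is the smallest constant for which the Lipschitz inequality with respect to $\|\cdot\|_a$ holds. Conventions on the decomposition: if $g$ has no linear components then $m=n$ and $\tilde g=g$ (so $\|\boldsymbol\beta\|_b=0$); otherwise the smallest possible $m$ is chosen; $m=0$ means $g$ is linear. Suprema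 are taken in $\mathbb{R}\cup\{+\infty\}$. Standing assumption: $g$ is non-constant. *)

theory Defs
  imports "HOL-Probability.Probability"
begin

text \<open>
  Points of \<open>\<real>\<^sup>n\<close> are extensional functions on \<open>{..<n}\<close>, so that the dimension \<open>n\<close> and the
  dimensions \<open>m\<close>, \<open>n - m\<close> of the two blocks of a decomposition (each possibly \<open>0\<close>) are ordinary
  natural numbers. The coordinates are numbered from \<open>0\<close>.
\<close>

definition Rn :: "nat \<Rightarrow> (nat \<Rightarrow> real) set" where
  "Rn n = {..<n} \<rightarrow>\<^sub>E UNIV"

definition borel_Rn :: "nat \<Rightarrow> (nat \<Rightarrow> real) measure" where
  "borel_Rn n = (\<Pi>\<^sub>M i\<in>{..<n}. borel)"

text \<open>
  The maximum is taken over a set with \<open>0\<close> inserted only to make the norm of the empty vector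
  (\<open>n = 0\<close>) equal to \<open>0\<close>.
\<close>

definition lnorm :: "ereal \<Rightarrow> nat \<Rightarrow> (nat \<Rightarrow> real) \<Rightarrow> real" where
  "lnorm a n x =
     (if a = \<infinity> then Max (insert 0 ((\<lambda>i. \<bar>x i\<bar>) ` {..<n}))
      else (\<Sum>i<n. \<bar>x i\<bar> powr real_of_ereal a) powr (1 / real_of_ereal a))"

definition lipschitz_ineq :: "real \<Rightarrow> nat \<Rightarrow> ((nat \<Rightarrow> real) \<Rightarrow> real) \<Rightarrow> real \<Rightarrow> bool" where
  "lipschitz_ineq a n f C \<longleftrightarrow>
     0 \<le> C \<and> (\<forall>x\<in>Rn n. \<forall>y\<in>Rn n. \<bar>f x - f y\<bar> \<le> C * lnorm (ereal a) n (\<lambda>i. x i - y i))"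

definition is_lipschitz_constant :: "real \<Rightarrow> nat \<Rightarrow> ((nat \<Rightarrow> real) \<Rightarrow> real) \<Rightarrow> real \<Rightarrow> bool" where
  "is_lipschitz_constant a n f C \<longleftrightarrow>
     lipschitz_ineq a n f C \<and> (\<forall>C'. lipschitz_ineq a n f C' \<longrightarrow> C \<le> C')"

definition linear_decomposition ::
    "nat \<Rightarrow> nat \<Rightarrow> ((nat \<Rightarrow> real) \<Rightarrow> real) \<Rightarrow> ((nat \<Rightarrow> real) \<Rightarrow> real) \<Rightarrow> (nat \<Rightarrow> real) \<Rightarrow> bool" where
  "linear_decomposition n m g gt \<beta> \<longleftrightarrow>
     m \<le> n \<and> (\<forall>x\<in>Rn n. g x = gt (restrict x {..<m}) + (\<Sum>i<n - m. \<beta> i * x (m + i)))"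

definition nonatomic :: "'w measure \<Rightarrow> bool" where
  "nonatomic M \<longleftrightarrow>
     (\<forall>A\<in>sets M. 0 < emeasure M A \<longrightarrow>
        (\<exists>B\<in>sets M. B \<subseteq> A \<and> 0 < emeasure M B \<and> emeasure M B < emeasure M A))"

definition Lp_vec :: "'w measure \<Rightarrow> real \<Rightarrow> real \<Rightarrow> nat \<Rightarrow> ('w \<Rightarrow> nat \<Rightarrow> real) set" where
  "Lp_vec M a p n =
     {X \<in> M \<rightarrow>\<^sub>M borel_Rn n. integrable M (\<lambda>\<omega>. lnorm (ereal a) n (X \<omega>) powr p)}"

definition cdf_vec :: "'w measure \<Rightarrow> nat \<Rightarrow> ('w \<Rightarrow> nat \<Rightarrow> real) \<Rightarrow> (nat \<Rightarrow> real) \<Rightarrow> real" where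
  "cdf_vec M n X x = measure M {\<omega> \<in> space M. \<forall>i<n. X \<omega> i \<le> x i}"

text \<open>
  Couplings are pairs of random vectors on the underlying space \<open>M\<close>. The infimum is only meaningful
  for distribution functions of random vectors on \<open>M\<close> with finite \<open>p\<close>-th moments: then the set is
  nonempty and all integrals are finite.
\<close>

definition wasserstein_vec ::
    "'w measure \<Rightarrow> real \<Rightarrow> real \<Rightarrow> nat \<Rightarrow> ((nat \<Rightarrow> real) \<Rightarrow> real) \<Rightarrow> ((nat \<Rightarrow> real) \<Rightarrow> real) \<Rightarrow> real" where
  "wasserstein_vec M a p n F G =
     Inf {(\<integral>\<omega>. lnorm (ereal a) n (\<lambda>i. X \<omega> i - Y \<omega> i) powr p \<partial>M) powr (1 / p) | X Y.
            X \<in> M \<rightarrow>\<^sub>M borel_Rn n \<and> Y \<in> M \<rightarrow>\<^sub>M borel_Rn n \<and>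
            cdf_vec M n X = F \<and> cdf_vec M n Y = G}"

definition uncertainty_vec ::
    "'w measure \<Rightarrow> real \<Rightarrow> real \<Rightarrow> nat \<Rightarrow> real \<Rightarrow> ('w \<Rightarrow> nat \<Rightarrow> real) \<Rightarrow> ('w \<Rightarrow> nat \<Rightarrow> real) set" where
  "uncertainty_vec M a p n \<epsilon> X =
     {Z \<in> Lp_vec M a p n. wasserstein_vec M a p n (cdf_vec M n Z) (cdf_vec M n X) \<le> \<epsilon>}"

text \<open>
  The univariate notions, for real-valued random variables; in dimension one every \<open>a\<close>-norm is
  the absolute value.
\<close>

definition Lp :: "'w measure \<Rightarrow> real \<Rightarrow> ('w \<Rightarrow> real) set" where
  "Lp M p = {X \<in> borel_measurable M. integrable M (\<lambda>\<omega>. \<bar>X \<omega>\<bar> powr p)}"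

definition wasserstein :: "'w measure \<Rightarrow> real \<Rightarrow> (real \<Rightarrow> real) \<Rightarrow> (real \<Rightarrow> real) \<Rightarrow> real" where
  "wasserstein M p F G =
     Inf {(\<integral>\<omega>. \<bar>X \<omega> - Y \<omega>\<bar> powr p \<partial>M) powr (1 / p) | X Y.
            X \<in> borel_measurable M \<and> Y \<in> borel_measurable M \<and>
            cdf (distr M borel X) = F \<and> cdf (distr M borel Y) = G}"

definition uncertainty :: "'w measure \<Rightarrow> real \<Rightarrow> real \<Rightarrow> ('w \<Rightarrow> real) \<Rightarrow> ('w \<Rightarrow> real) set" where
  "uncertainty M p \<epsilon> X =
     {Z \<in> Lp M p. wasserstein M p (cdf (distr M borel Z)) (cdf (distr M borel X)) \<le> \<epsilon>}"

definition law_invariant :: "'w measure \<Rightarrow> real \<Rightarrow> (('w \<Rightarrow> real) \<Rightarrow> real) \<Rightarrow> bool" where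
  "law_invariant M p \<rho> \<longleftrightarrow>
     (\<forall>X\<in>Lp M p. \<forall>Y\<in>Lp M p. distr M borel X = distr M borel Y \<longrightarrow> \<rho> X = \<rho> Y)"

end

theory Submission imports Defs begin

text \<open>
  The right-hand inequality holds because composing a coupling with \<open>g\<close> multiplies its cost by at
  most \<open>K\<close>. For the left-hand one, let \<open>T = g(X)\<close> and let \<open>Y\<close> have distance at most \<open>\<parallel>\<beta>\<parallel>\<^sub>b \<epsilon>\<close> from
  \<open>T\<close>. Points of \<open>\<real>\<^sup>n\<close> are null sets of a non-atomic measure, so an injection of \<open>\<real>\<^sup>n\<close> into \<open>\<real>\<close> is a
  random variable without atoms; breaking the ties of \<open>T\<close> with it yields a uniform variable
  \<open>U\<close> whose quantile transform is \<open>T\<close> itself, and \<open>Y' = F\<^sub>Y\<^sup>-\<^sup>1(U)\<close> is a copy of \<open>Y\<close> that is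
  comonotone with \<open>T\<close>. The comonotone coupling attains the Wasserstein distance, as the power cost
  is a mixture of hinge costs, whose expectations are integrals of joint tail probabilities. Since
  \<open>T\<close> itself is one half of the optimal coupling, no gluing is needed: moving the linear coordinates
  of \<open>X\<close> along a vector dual to \<open>\<beta>\<close> by \<open>(Y' - T) / \<parallel>\<beta>\<parallel>\<^sub>b\<close> gives \<open>Z\<close> with \<open>g(Z) = Y'\<close> at
  cost at most \<open>\<epsilon>\<close>. In the equality cases Hoelder's inequality gives \<open>K \<le> \<parallel>\<beta>\<parallel>\<^sub>b\<close>.
\<close>

section \<open>A random variable without atoms\<close>

lemma ternary_digits_summable: "summable (\<lambda>k. of_bool (c k) * (1/3::real)^k)"
  by (rule summable_comparison_test'[OF summable_geometric[of "1/3::real"], of 0]) auto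

lemma ternary_digits_step:
  "(\<Sum>k. of_bool (c k) * (1/3::real)^k) = of_bool (c 0) + (\<Sum>k. of_bool (c (Suc k)) * (1/3)^k) / 3"
proof -
  have "(\<Sum>k. of_bool (c k) * (1/3::real)^k)
      = of_bool (c 0) + (\<Sum>k. of_bool (c (Suc k)) * (1/3)^Suc k)"
    using suminf_split_head[OF ternary_digits_summable[of c]] by simp
  also have "(\<Sum>k. of_bool (c (Suc k)) * (1/3::real)^Suc k)
      = (\<Sum>k. of_bool (c (Suc k)) * (1/3)^k) / 3"
    using suminf_divide[OF ternary_digits_summable[of "\<lambda>k. c (Suc k)"], of 3] by simp
  finally show ?thesis .
qed

lemma ternary_digits_bounds:
  "0 \<le> (\<Sum>k. of_bool (c k) * (1/3::real)^k)" "(\<Sum>k. of_bool (c k) * (1/3::real)^k) \<le> 3/2"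
proof -
  show "0 \<le> (\<Sum>k. of_bool (c k) * (1/3::real)^k)"
    by (intro suminf_nonneg ternary_digits_summable) auto
  have "(\<Sum>k. of_bool (c k) * (1/3::real)^k) \<le> (\<Sum>k. (1/3::real)^k)"
    by (intro suminf_le ternary_digits_summable summable_geometric) auto
  then show "(\<Sum>k. of_bool (c k) * (1/3::real)^k) \<le> 3/2"
    using suminf_geometric[of "1/3::real"] by simp
qed

text \<open>The digits are 0 or 1, so all digits after the leading one contribute at most 1/3 * 3/2
  = 1/2, less than the gap 1 between two leading digits. Hence the leading digit is determined, and
  induction strips it off. Base 3 avoids the double expansions of base 2.\<close>

lemma ternary_digits_inj:
  assumes "(\<Sum>k. of_bool (c k) * (1/3::real)^k) = (\<Sum>k. of_bool (d k) * (1/3)^k)"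
  shows "c k = d k"
  using assms
proof (induction k arbitrary: c d)
  case 0
  then show ?case
    using ternary_digits_step[of c] ternary_digits_step[of d]
      ternary_digits_bounds[of "\<lambda>k. c (Suc k)"] ternary_digits_bounds[of "\<lambda>k. d (Suc k)"]
    by (cases "c 0"; cases "d 0") auto
next
  case (Suc k)
  have "c 0 = d 0"
    using Suc.prems ternary_digits_step[of c] ternary_digits_step[of d]
      ternary_digits_bounds[of "\<lambda>k. c (Suc k)"] ternary_digits_bounds[of "\<lambda>k. d (Suc k)"]
    by (cases "c 0"; cases "d 0") auto
  then show ?case
    using Suc.prems Suc.IH[of "\<lambda>k. c (Suc k)" "\<lambda>k. d (Suc k)"] ternary_digits_step[of c] ternary_digits_step[of d]
    by simp
qed

lemma space_borel_Rn [simp]: "space (borel_Rn n) = Rn n"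
  by (simp add: borel_Rn_def Rn_def space_PiM)

lemma measurable_borel_Rn_component [measurable]:
  "i < n \<Longrightarrow> (\<lambda>x. x i) \<in> borel_measurable (borel_Rn n)"
  unfolding borel_Rn_def by simp

text \<open>
  The digits of \<open>\<psi> x\<close> in base \<open>3\<close> record the comparisons of the coordinates of \<open>x\<close> with all rationals.
\<close>

lemma exists_bounded_injection_Rn:
  obtains \<psi> :: "(nat \<Rightarrow> real) \<Rightarrow> real" where
    "\<psi> \<in> borel_measurable (borel_Rn n)" "inj_on \<psi> (Rn n)" "\<And>x. 0 \<le> \<psi> x" "\<And>x. \<psi> x \<le> 3/2"
proof -
  \<comment> \<open>\<open>from_nat k\<close> runs through all pairs of a coordinate index and a
    rational; digits whose index is at least \<open>n\<close> are constantly 0.\<close>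
  define c where "c x k = (fst (from_nat k :: nat \<times> rat) < n \<and>
      x (fst (from_nat k :: nat \<times> rat)) < of_rat (snd (from_nat k :: nat \<times> rat)))"
    for x :: "nat \<Rightarrow> real" and k
  define \<psi> where "\<psi> x = (\<Sum>k. of_bool (c x k) * (1/3::real)^k)" for x
  have [measurable]: "(\<lambda>x. of_bool (c x k) :: real) \<in> borel_measurable (borel_Rn n)" for k
    unfolding c_def by (cases "fst (from_nat k :: nat \<times> rat) < n") simp_all
  show thesis
  proof
    show "\<psi> \<in> borel_measurable (borel_Rn n)"
      unfolding \<psi>_def by measurable
    show "inj_on \<psi> (Rn n)"
    proof (intro inj_onI ext)
      fix x y i assume x: "x \<in> Rn n" and y: "y \<in> Rn n" and eq: "\<psi> x = \<psi> y"
      show "x i = y i"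
      proof (cases "i < n")
        case True
        have iff: "x i < of_rat q \<longleftrightarrow> y i < of_rat q" for q
          using ternary_digits_inj[of "c x" "c y" "to_nat (i, q)"] eq True
          by (simp add: \<psi>_def c_def)
        show ?thesis
        proof (rule ccontr)
          assume "x i \<noteq> y i"
          then consider "x i < y i" | "y i < x i" by linarith
          then show False
            by cases (metis iff of_rat_dense less_asym)+
        qed
      next
        case False
        then show ?thesis using x y by (auto simp: Rn_def PiE_def extensional_def)
      qed
    qed
    show "0 \<le> \<psi> x" "\<psi> x \<le> 3/2" for x
      unfolding \<psi>_def by (fact ternary_digits_bounds)+
  qed
qed

text \<open>By injectivity a level set of \<open>V\<close> has at most one point. If it had positive
  mass, non-atomicity would give a subset of smaller positive mass; but a nonempty subset of a
  singleton is the whole singleton.\<close>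

lemma nonatomic_imp_atomless_variable:
  assumes "prob_space M" and sets: "sets M = sets (borel_Rn n)" and na: "nonatomic M"
  obtains V :: "(nat \<Rightarrow> real) \<Rightarrow> real" where
    "V \<in> borel_measurable M" "\<And>\<omega>. 0 \<le> V \<omega>" "\<And>\<omega>. V \<omega> \<le> 3/2"
    "\<And>u. measure M {\<omega> \<in> space M. V \<omega> = u} = 0"
proof -
  interpret prob_space M by fact
  obtain V :: "(nat \<Rightarrow> real) \<Rightarrow> real" where V: "V \<in> borel_measurable (borel_Rn n)" "inj_on V (Rn n)"
      "\<And>x. 0 \<le> V x" "\<And>x. V x \<le> 3/2"
    by (rule exists_bounded_injection_Rn[of n]) blast
  have V' [measurable]: "V \<in> borel_measurable M"
    using V(1) measurable_cong_sets[OF sets refl] by blast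
  have space: "space M = Rn n"
    using sets_eq_imp_space_eq[OF sets] by simp
  have "measure M {\<omega> \<in> space M. V \<omega> = u} = 0" for u
  proof (rule ccontr)
    let ?A = "{\<omega> \<in> space M. V \<omega> = u}"
    assume "measure M ?A \<noteq> 0"
    then have "0 < emeasure M ?A"
      by (simp add: emeasure_eq_measure zero_less_measure_iff)
    moreover have "?A \<in> sets M" by measurable
    ultimately obtain B where B: "B \<subseteq> ?A" "0 < emeasure M B" "emeasure M B < emeasure M ?A"
      using na unfolding nonatomic_def by blast
    have "B \<noteq> {}" using B(2) by auto
    then have "B = ?A"
      using B(1) V(2) unfolding inj_on_def space by blast
    then show False using B(3) by simp
  qed
  then show thesis using that V' V(3,4) by blast
qed

section \<open>The comonotone coupling\<close>

text \<open>
  The randomised rank \<open>U\<close> of \<open>T\<close>: ties of \<open>T\<close> are broken by the atomless variable \<open>V\<close>, that is,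
  \<open>U \<omega>\<close> is the probability of the pairs \<open>(T, V)\<close> lexicographically below \<open>(T \<omega>, V \<omega>)\<close>.
\<close>

lemma (in prob_space) distributional_transform:
  fixes T V :: "'a \<Rightarrow> real"
  assumes [measurable]: "T \<in> borel_measurable M" "V \<in> borel_measurable M"
    and V: "\<And>\<omega>. 0 \<le> V \<omega>" "\<And>\<omega>. V \<omega> \<le> 3/2"
    and atomless: "\<And>u. prob {\<omega> \<in> space M. V \<omega> = u} = 0"
  obtains U :: "'a \<Rightarrow> real" where
    "U \<in> borel_measurable M"
    "\<And>v. 0 \<le> v \<Longrightarrow> v \<le> 1 \<Longrightarrow> prob {\<omega> \<in> space M. U \<omega> \<le> v} = v"
    "\<And>t. AE \<omega> in M. T \<omega> \<le> t \<longleftrightarrow> U \<omega> \<le> cdf (distr M borel T) t"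
proof -
  define below where "below t u \<omega> \<longleftrightarrow> T \<omega> < t \<or> T \<omega> = t \<and> V \<omega> \<le> u" for t u \<omega>
  \<comment> \<open>As an integral depending on a parameter, \<open>U\<close> is measurable by the
    Fubini machinery; the fact \<open>U\<close> below turns it back into a probability.\<close>
  define U where "U \<omega> = (\<integral>\<omega>'. of_bool (below (T \<omega>) (V \<omega>) \<omega>') \<partial>M :: real)" for \<omega>
  let ?F = "cdf (distr M borel T)"
  interpret T: cdf_distribution "distr M borel T"
    by (simp add: cdf_distribution_def real_distribution_distr)
  have F: "?F t = prob {\<omega> \<in> space M. T \<omega> \<le> t}" for t
    by (simp add: cdf_def measure_distr vimage_def Int_def conj_commute)
  have [measurable]: "Measurable.pred M (below t u)" for t u
    unfolding below_def by measurable
  have U: "U \<omega> = prob {\<omega>' \<in> space M. below (T \<omega>) (V \<omega>) \<omega>'}" for \<omega>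
  proof -
    have "U \<omega> = (\<integral>\<omega>'. indicator {\<omega>' \<in> space M. below (T \<omega>) (V \<omega>) \<omega>'} \<omega>' \<partial>M)"
      unfolding U_def by (intro Bochner_Integration.integral_cong) (auto simp: indicator_def)
    then show ?thesis by simp
  qed
  have U_meas [measurable]: "U \<in> borel_measurable M"
    unfolding U_def below_def by measurable
  have U01: "0 \<le> U \<omega>" "U \<omega> \<le> 1" for \<omega>
    by (simp_all add: U)

  \<comment> \<open>Every level strictly between 0 and 1 is the mass of a lexicographic initial
    segment. At the quantile \<open>t\<close> of level \<open>v\<close>, the mass of T < t is at
    most \<open>v\<close> and that of T \<le> t is at least \<open>v\<close>; in between, the mass
    grows continuously with the tie-breaking bound \<open>u\<close>.\<close>
  have cut: "\<exists>t u. prob {\<omega> \<in> space M. below t u \<omega>} = v" if v: "0 < v" "v < 1" for v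
  proof -
    define t where "t = T.I v"
    \<comment> \<open>For \<open>u\<close> between -1/2 and 2 the event W \<le> u is exactly
      \<open>below t u\<close>: the values -1 and 3 lie on either side of this interval, and the
      range of \<open>V\<close> lies inside it. So the segments become sublevel sets of one
      variable, to whose cdf the intermediate value theorem applies.\<close>
    define W where "W \<omega> = (if T \<omega> < t then - 1 else if T \<omega> = t then V \<omega> else 3)" for \<omega>
    have [measurable]: "W \<in> borel_measurable M"
      unfolding W_def by measurable
    interpret W: finite_borel_measure "distr M borel W"
      by (intro real_distribution.finite_borel_measure_M real_distribution_distr) simp
    have W: "cdf (distr M borel W) u = prob {\<omega> \<in> space M. W \<omega> \<le> u}" for u
      by (simp add: cdf_def measure_distr vimage_def Int_def conj_commute)
    have cont: "isCont (cdf (distr M borel W)) u" if u: "-1/2 \<le> u" "u \<le> 2" for u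
    proof -
      have "prob {\<omega> \<in> space M. W \<omega> = u} \<le> prob {\<omega> \<in> space M. V \<omega> = u}"
        using u by (intro finite_measure_mono) (auto simp: W_def split: if_splits)
      then have "prob {\<omega> \<in> space M. W \<omega> = u} = 0"
        using atomless[of u] measure_nonneg[of M "{\<omega> \<in> space M. W \<omega> = u}"] by linarith
      then have "measure (distr M borel W) {u} = 0"
        by (simp add: measure_distr vimage_def Int_def conj_commute)
      then show ?thesis by (simp add: W.isCont_cdf)
    qed
    have "prob {\<omega> \<in> space M. W \<omega> \<le> -1/2} \<le> prob {\<omega> \<in> space M. T \<omega> < t}"
    proof (intro finite_measure_mono subsetI)
      fix \<omega> assume "\<omega> \<in> {\<omega> \<in> space M. W \<omega> \<le> -1/2}"
      then show "\<omega> \<in> {\<omega> \<in> space M. T \<omega> < t}"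
        using V(1)[of \<omega>] by (auto simp: W_def split: if_splits)
    qed simp
    also have "\<dots> = measure (distr M borel T) {..<t}"
      by (simp add: measure_distr vimage_def Int_def conj_commute)
    also have "\<dots> \<le> v"
    proof (rule tendsto_upperbound[OF T.cdf_at_left])
      have "?F x < v" if "x < t" for x
        using T.pseudoinverse[OF v, of x] that by (auto simp: t_def not_le)
      then show "\<forall>\<^sub>F x in at_left t. ?F x \<le> v"
        by (auto simp: eventually_at_filter less_imp_le)
    qed simp
    finally have lo: "cdf (distr M borel W) (-1/2) \<le> v" by (simp add: W)
    have "v \<le> ?F t"
      using T.pseudoinverse[OF v, of t] unfolding t_def by blast
    also have "\<dots> \<le> prob {\<omega> \<in> space M. W \<omega> \<le> 2}"
      unfolding F
    proof (intro finite_measure_mono subsetI)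
      fix \<omega> assume "\<omega> \<in> {\<omega> \<in> space M. T \<omega> \<le> t}"
      then show "\<omega> \<in> {\<omega> \<in> space M. W \<omega> \<le> 2}"
        using V(2)[of \<omega>] by (auto simp: W_def)
    qed simp
    finally have hi: "v \<le> cdf (distr M borel W) 2" by (simp add: W)
    obtain u where u: "-1/2 \<le> u" "u \<le> 2" "cdf (distr M borel W) u = v"
      using IVT[where f="cdf (distr M borel W)", OF lo hi] cont by auto
    have "{\<omega> \<in> space M. below t u \<omega>} = {\<omega> \<in> space M. W \<omega> \<le> u}"
      using u by (auto simp: W_def below_def)
    then have "prob {\<omega> \<in> space M. below t u \<omega>} = v"
      using u(3) by (simp add: W)
    then show ?thesis by blast
  qed

  \<comment> \<open>Compare with a segment of mass \<open>v\<close>: a point inside it has its own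
    segment contained in it, so its rank is at most \<open>v\<close>; a point outside has a segment
    containing it, so its rank is at least \<open>v\<close>.\<close>
  have U_le: "v \<le> prob {\<omega> \<in> space M. U \<omega> \<le> v}" and U_less: "prob {\<omega> \<in> space M. U \<omega> < v} \<le> v"
    if v: "0 < v" "v < 1" for v
  proof -
    obtain t u where tu: "prob {\<omega> \<in> space M. below t u \<omega>} = v"
      using cut[OF v] by blast
    have "U \<omega> \<le> v" if "below t u \<omega>" for \<omega>
      unfolding U tu[symmetric] using that by (intro finite_measure_mono) (auto simp: below_def)
    then show "v \<le> prob {\<omega> \<in> space M. U \<omega> \<le> v}"
      by (subst tu[symmetric], intro finite_measure_mono) auto
    have "v \<le> U \<omega>" if "\<not> below t u \<omega>" for \<omega>
      unfolding U tu[symmetric] using that by (intro finite_measure_mono) (auto simp: below_def)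
    then show "prob {\<omega> \<in> space M. U \<omega> < v} \<le> v"
      by (subst (2) tu[symmetric], intro finite_measure_mono) (auto simp: not_le[symmetric])
  qed
  \<comment> \<open>Letting the level decrease to \<open>v\<close> turns the bound for the strict
    inequality into one for the weak inequality.\<close>
  have U_le': "prob {\<omega> \<in> space M. U \<omega> \<le> v} \<le> v" if v: "0 \<le> v" "v < 1" for v
  proof (rule dense_ge_bounded[OF v(2)])
    fix w assume w: "v < w" "w < 1"
    then have "prob {\<omega> \<in> space M. U \<omega> \<le> v} \<le> prob {\<omega> \<in> space M. U \<omega> < w}"
      by (intro finite_measure_mono) auto
    also have "\<dots> \<le> w" using U_less[of w] w v by simp
    finally show "prob {\<omega> \<in> space M. U \<omega> \<le> v} \<le> w" .
  qed
  have unif: "prob {\<omega> \<in> space M. U \<omega> \<le> v} = v" if v: "0 \<le> v" "v \<le> 1" for v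
  proof -
    consider "v = 0" | "v = 1" | "0 < v" "v < 1" using v by linarith
    then show ?thesis
    proof cases
      case 1
      then show ?thesis using U_le'[of 0] by (simp add: measure_le_0_iff)
    next
      case 2
      then show ?thesis by (simp add: U01 prob_space)
    next
      case 3
      then show ?thesis using U_le U_le' by (intro antisym) auto
    qed
  qed
  show thesis
  proof
    show "U \<in> borel_measurable M" by fact
    show "prob {\<omega> \<in> space M. U \<omega> \<le> v} = v" if "0 \<le> v" "v \<le> 1" for v
      using unif that .
    fix t
    have imp: "U \<omega> \<le> ?F t" if "T \<omega> \<le> t" for \<omega>
      unfolding U F using that by (intro finite_measure_mono) (auto simp: below_def)
    \<comment> \<open>By \<open>imp\<close> one event contains the other, and both have probability
      \<open>?F t\<close>, the larger one by uniformity of \<open>U\<close>. Their difference is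
      therefore null.\<close>
    have "prob ({\<omega> \<in> space M. U \<omega> \<le> ?F t} - {\<omega> \<in> space M. T \<omega> \<le> t}) = 0"
      using imp unif[of "?F t"]
      by (subst finite_measure_Diff) (auto simp: F)
    then have "AE \<omega> in M. \<omega> \<notin> {\<omega> \<in> space M. U \<omega> \<le> ?F t} - {\<omega> \<in> space M. T \<omega> \<le> t}"
      by (intro AE_not_in) (simp add: null_sets_def emeasure_eq_measure)
    with AE_space show "AE \<omega> in M. T \<omega> \<le> t \<longleftrightarrow> U \<omega> \<le> ?F t"
      by eventually_elim (use imp in auto)
  qed
qed

section \<open>Joint tail probabilities of couplings on the real line\<close>

context prob_space
begin

lemma cdf_distr_eq:
  "X \<in> borel_measurable M \<Longrightarrow> cdf (distr M borel X) t = prob {\<omega> \<in> space M. X \<omega> \<le> t}"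
  by (simp add: cdf_def measure_distr vimage_def Int_def conj_commute)

text \<open>This is the Frechet lower bound, valid for every coupling. Comonotone pairs attain it
  for all \<open>s\<close> and \<open>t\<close>, which is the source of their optimality.\<close>

lemma prob_le_and_gt_ge:
  fixes A B :: "'a \<Rightarrow> real"
  assumes [measurable]: "A \<in> borel_measurable M" "B \<in> borel_measurable M"
  shows "max 0 (cdf (distr M borel B) s - cdf (distr M borel A) t)
    \<le> prob {\<omega> \<in> space M. B \<omega> \<le> s \<and> t < A \<omega>}"
proof -
  have "prob {\<omega> \<in> space M. B \<omega> \<le> s} - prob {\<omega> \<in> space M. A \<omega> \<le> t}
      \<le> prob ({\<omega> \<in> space M. B \<omega> \<le> s} - {\<omega> \<in> space M. A \<omega> \<le> t})"
    by (subst finite_measure_Diff') (auto intro!: finite_measure_mono)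
  also have "\<dots> = prob {\<omega> \<in> space M. B \<omega> \<le> s \<and> t < A \<omega>}"
    by (intro arg_cong[where f=prob]) auto
  finally show ?thesis by (simp add: cdf_distr_eq)
qed

text \<open>The variable \<open>Y'\<close> is the quantile function of \<open>Y\<close> at the randomised rank of \<open>T\<close>.\<close>

lemma exists_comonotone:
  fixes T V Y :: "'a \<Rightarrow> real"
  assumes [measurable]: "T \<in> borel_measurable M" "V \<in> borel_measurable M" "Y \<in> borel_measurable M"
    and V: "\<And>\<omega>. 0 \<le> V \<omega>" "\<And>\<omega>. V \<omega> \<le> 3/2"
    and atomless: "\<And>u. prob {\<omega> \<in> space M. V \<omega> = u} = 0"
  obtains Y' :: "'a \<Rightarrow> real" where
    "Y' \<in> borel_measurable M" "distr M borel Y' = distr M borel Y"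
    "\<And>s t. prob {\<omega> \<in> space M. T \<omega> \<le> s \<and> t < Y' \<omega>}
        = max 0 (cdf (distr M borel T) s - cdf (distr M borel Y) t)"
    "\<And>s t. prob {\<omega> \<in> space M. Y' \<omega> \<le> s \<and> t < T \<omega>}
        = max 0 (cdf (distr M borel Y) s - cdf (distr M borel T) t)"
proof -
  obtain U where [measurable]: "U \<in> borel_measurable M"
    and unif: "\<And>v. 0 \<le> v \<Longrightarrow> v \<le> 1 \<Longrightarrow> prob {\<omega> \<in> space M. U \<omega> \<le> v} = v"
    and T: "\<And>t. AE \<omega> in M. T \<omega> \<le> t \<longleftrightarrow> U \<omega> \<le> cdf (distr M borel T) t"
    using distributional_transform[OF assms(1,2) V atomless] by blast
  interpret T: cdf_distribution "distr M borel T"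
    by (simp add: cdf_distribution_def real_distribution_distr)
  interpret Y: cdf_distribution "distr M borel Y"
    by (simp add: cdf_distribution_def real_distribution_distr)
  \<comment> \<open>The quantile function is controlled only on the open unit interval. The default
    0 outside makes \<open>Q\<close> measurable on the whole line and is met only on the null set
    where \<open>U\<close> leaves that interval.\<close>
  define Q where "Q u = (if u \<in> {0<..<1} then Y.I u else 0)" for u
  have [measurable]: "Q \<in> borel_measurable borel"
    unfolding Q_def using Y.measurable_CI
    by (subst (asm) measurable_restrict_space_iff[where c=0]) auto
  define Y' where "Y' \<omega> = Q (U \<omega>)" for \<omega>
  have [measurable]: "Y' \<in> borel_measurable M"
    unfolding Y'_def by measurable
  have "AE \<omega> in M. 0 < U \<omega>"
    using unif[of 0] prob_neg[of "\<lambda>\<omega>. U \<omega> \<le> 0"] by (subst AE_iff_measurable[OF _ refl]) (auto simp: emeasure_eq_measure not_less)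
  moreover have "AE \<omega> in M. U \<omega> < 1"
  proof -
    have "prob {\<omega> \<in> space M. 1 \<le> U \<omega>} \<le> 0"
    proof (rule field_le_epsilon)
      fix e :: real assume "0 < e"
      \<comment> \<open>The distribution of \<open>U\<close> is known only at levels in [0, 1]; the
        maximum keeps \<open>w\<close> there when e > 1.\<close>
      define w where "w = max 0 (1 - e)"
      have "prob {\<omega> \<in> space M. 1 \<le> U \<omega>} \<le> prob (space M - {\<omega> \<in> space M. U \<omega> \<le> w})"
        using \<open>0 < e\<close> by (intro finite_measure_mono) (auto simp: w_def)
      also have "\<dots> = 1 - w"
        using unif[of w] \<open>0 < e\<close> by (subst prob_compl) (auto simp: w_def)
      finally show "prob {\<omega> \<in> space M. 1 \<le> U \<omega>} \<le> 0 + e"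
        by (simp add: w_def)
    qed
    then show ?thesis
      by (subst AE_iff_measurable[OF _ refl]) (auto simp: emeasure_eq_measure not_less measure_le_0_iff)
  qed
  ultimately have Y': "AE \<omega> in M. Y' \<omega> \<le> t \<longleftrightarrow> U \<omega> \<le> cdf (distr M borel Y) t" for t
  proof eventually_elim
    case (elim \<omega>)
    then show ?case
      using Y.pseudoinverse[of "U \<omega>" t] by (simp add: Y'_def Q_def)
  qed
  have F01: "0 \<le> cdf (distr M borel T) t" "cdf (distr M borel T) t \<le> 1"
    "0 \<le> cdf (distr M borel Y) t" "cdf (distr M borel Y) t \<le> 1" for t
    by (simp_all add: T.cdf_nonneg T.cdf_bounded_prob Y.cdf_nonneg Y.cdf_bounded_prob)
  \<comment> \<open>Up to null sets, events in \<open>T\<close> and in \<open>Y'\<close> are both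
    events in the single variable \<open>U\<close>. For such nested events the Frechet bound becomes
    an equality.\<close>
  have nested: "prob {\<omega> \<in> space M. U \<omega> \<le> v \<and> w < U \<omega>} = max 0 (v - w)"
    if "0 \<le> v" "v \<le> 1" "0 \<le> w" "w \<le> 1" for v w
  proof (cases "w \<le> v")
    case True
    have *: "{\<omega> \<in> space M. U \<omega> \<le> v \<and> w < U \<omega>} = {\<omega> \<in> space M. U \<omega> \<le> v} - {\<omega> \<in> space M. U \<omega> \<le> w}"
      by auto
    have "prob ({\<omega> \<in> space M. U \<omega> \<le> v} - {\<omega> \<in> space M. U \<omega> \<le> w})
        = prob {\<omega> \<in> space M. U \<omega> \<le> v} - prob {\<omega> \<in> space M. U \<omega> \<le> w}"
      using True by (intro finite_measure_Diff) auto
    then show ?thesis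
      unfolding * using that True by (simp add: unif)
  next
    case False
    then have "{\<omega> \<in> space M. U \<omega> \<le> v \<and> w < U \<omega>} = {}" by auto
    then show ?thesis using False by (simp only:) simp
  qed
  show thesis
  proof
    show "Y' \<in> borel_measurable M" by measurable
    show "distr M borel Y' = distr M borel Y"
    proof (rule cdf_unique)
      show "cdf (distr M borel Y') = cdf (distr M borel Y)"
      proof
        fix t
        have "cdf (distr M borel Y') t = prob {\<omega> \<in> space M. U \<omega> \<le> cdf (distr M borel Y) t}"
          unfolding cdf_distr_eq[OF \<open>Y' \<in> borel_measurable M\<close>]
          using Y'[of t] by (intro finite_measure_eq_AE) auto
        then show "cdf (distr M borel Y') t = cdf (distr M borel Y) t"
          by (simp add: unif F01)
      qed
    qed (simp_all add: real_distribution_distr)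
    fix s t
    have "prob {\<omega> \<in> space M. T \<omega> \<le> s \<and> t < Y' \<omega>}
        = prob {\<omega> \<in> space M. U \<omega> \<le> cdf (distr M borel T) s \<and> cdf (distr M borel Y) t < U \<omega>}"
      using T[of s] Y'[of t] by (intro finite_measure_eq_AE) (auto simp flip: not_le)
    then show "prob {\<omega> \<in> space M. T \<omega> \<le> s \<and> t < Y' \<omega>}
        = max 0 (cdf (distr M borel T) s - cdf (distr M borel Y) t)"
      by (simp add: nested F01)
    have "prob {\<omega> \<in> space M. Y' \<omega> \<le> s \<and> t < T \<omega>}
        = prob {\<omega> \<in> space M. U \<omega> \<le> cdf (distr M borel Y) s \<and> cdf (distr M borel T) t < U \<omega>}"
      using T[of t] Y'[of s] by (intro finite_measure_eq_AE) (auto simp flip: not_le)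
    then show "prob {\<omega> \<in> space M. Y' \<omega> \<le> s \<and> t < T \<omega>}
        = max 0 (cdf (distr M borel Y) s - cdf (distr M borel T) t)"
      by (simp add: nested F01)
  qed
qed

text \<open>Since \<open>ennreal\<close> sends negative reals to 0, the integrand is the positive
  part of A - B - s, which is the length of the interval from B + s to A. Tonelli exchanges this
  length with the expectation.\<close>

lemma nn_integral_hinge:
  fixes A B :: "'a \<Rightarrow> real"
  assumes [measurable]: "A \<in> borel_measurable M" "B \<in> borel_measurable M"
  shows "(\<integral>\<^sup>+\<omega>. ennreal (A \<omega> - B \<omega> - s) \<partial>M)
    = (\<integral>\<^sup>+t. emeasure M {\<omega> \<in> space M. B \<omega> \<le> t - s \<and> t < A \<omega>} \<partial>lborel)"
proof -
  interpret pair_sigma_finite M lborel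
    by (intro pair_sigma_finite.intro sigma_finite_measure_axioms sigma_finite_lborel)
  have "(\<integral>\<^sup>+\<omega>. ennreal (A \<omega> - B \<omega> - s) \<partial>M)
      = (\<integral>\<^sup>+\<omega>. (\<integral>\<^sup>+t. indicator {B \<omega> + s..<A \<omega>} t \<partial>lborel) \<partial>M)"
  proof (rule nn_integral_cong)
    fix \<omega>
    show "ennreal (A \<omega> - B \<omega> - s) = (\<integral>\<^sup>+t. indicator {B \<omega> + s..<A \<omega>} t \<partial>lborel)"
      by (cases "B \<omega> + s \<le> A \<omega>") (auto simp: algebra_simps ennreal_neg)
  qed
  also have "\<dots> = (\<integral>\<^sup>+\<omega>. (\<integral>\<^sup>+t. of_bool (B \<omega> \<le> t - s \<and> t < A \<omega>) \<partial>lborel) \<partial>M)"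
    by (intro nn_integral_cong) (auto simp: indicator_def algebra_simps)
  also have "\<dots> = (\<integral>\<^sup>+t. (\<integral>\<^sup>+\<omega>. of_bool (B \<omega> \<le> t - s \<and> t < A \<omega>) \<partial>M) \<partial>lborel)"
    by (rule Fubini'[symmetric]) measurable
  also have "\<dots> = (\<integral>\<^sup>+t. emeasure M {\<omega> \<in> space M. B \<omega> \<le> t - s \<and> t < A \<omega>} \<partial>lborel)"
  proof (intro nn_integral_cong)
    fix t
    have "(\<integral>\<^sup>+\<omega>. of_bool (B \<omega> \<le> t - s \<and> t < A \<omega>) \<partial>M)
        = (\<integral>\<^sup>+\<omega>. indicator {\<omega> \<in> space M. B \<omega> \<le> t - s \<and> t < A \<omega>} \<omega> \<partial>M)"
      by (intro nn_integral_cong) (auto simp: indicator_def)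
    then show "(\<integral>\<^sup>+\<omega>. of_bool (B \<omega> \<le> t - s \<and> t < A \<omega>) \<partial>M)
        = emeasure M {\<omega> \<in> space M. B \<omega> \<le> t - s \<and> t < A \<omega>}" by simp
  qed
  finally show ?thesis .
qed

end

text \<open>
  Writing a power cost as a mixture of the hinge costs \<open>(z - s)\<^sup>+\<close> with Taylor weight
  \<open>d\<^sup>2/ds\<^sup>2 s\<^sup>p\<close>.
\<close>

lemma powr_eq_nn_integral_hinge:
  assumes p: "1 < p" and z: "0 \<le> z"
  shows "ennreal (z powr p)
    = (\<integral>\<^sup>+s. ennreal (indicator {0..} s * (p * (p - 1) * s powr (p - 2))) * ennreal (z - s) \<partial>lborel)"
proof -
  define f where "f s = p * (p - 1) * s powr (p - 2) * (z - s)" for s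
  \<comment> \<open>An antiderivative of \<open>f\<close> with \<open>F 0 = 0\<close> and
    \<open>F z = z powr p\<close>.\<close>
  define F where "F s = p * z * s powr (p - 1) - (p - 1) * s powr p" for s
  have "(f has_integral (F z - F 0)) {0..z}"
  \<comment> \<open>For p < 2 the weight is unbounded near 0, so differentiability is used only in
    the interior and continuity at the end points.\<close>
  proof (rule fundamental_theorem_of_calculus_interior[OF z])
    show "continuous_on {0..z} F"
      unfolding F_def using p by (intro continuous_intros continuous_on_powr') auto
    fix s assume "s \<in> {0<..<z}"
    then have s: "0 < s" by simp
    note d = has_real_derivative_powr[OF s]
    have "(F has_real_derivative
        p * z * ((p - 1) * s powr (p - 1 - 1)) - (p - 1) * (p * s powr (p - 1))) (at s)"
      unfolding F_def by (intro DERIV_diff DERIV_cmult d)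
    also have "p * z * ((p - 1) * s powr (p - 1 - 1)) - (p - 1) * (p * s powr (p - 1)) = f s"
      using powr_mult_base[of s "p - 2"] s by (simp add: f_def algebra_simps)
    finally have "(F has_real_derivative f s) (at s)" .
    then show "(F has_vector_derivative f s) (at s)"
      by (simp add: has_real_derivative_iff_has_vector_derivative)
  qed
  moreover have "F z - F 0 = z powr p"
    using p z by (cases "z = 0") (auto simp: F_def powr_diff field_simps)
  ultimately have I: "(f has_integral z powr p) {0..z}" by simp
  have nonneg: "0 \<le> f s" if "s \<in> {0..z}" for s
    using that p by (simp add: f_def)
  have "ennreal (z powr p) = (\<integral>\<^sup>+s. ennreal (f s) * indicator {0..z} s \<partial>lborel)"
    using nn_integral_has_integral_lebesgue'[OF nonneg I] by simp
  also have "\<dots> = (\<integral>\<^sup>+s. ennreal (indicator {0..} s * (p * (p - 1) * s powr (p - 2))) * ennreal (z - s) \<partial>lborel)"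
  proof (rule nn_integral_cong)
    fix s
    show "ennreal (f s) * indicator {0..z} s
      = ennreal (indicator {0..} s * (p * (p - 1) * s powr (p - 2))) * ennreal (z - s)"
      using p unfolding f_def
      by (cases "0 \<le> s"; cases "s \<le> z") (auto simp: ennreal_mult' ennreal_neg indicator_def)
  qed
  finally show ?thesis .
qed

text \<open>For s \<ge> 0 at most one of the two differences exceeds \<open>s\<close>, so at most
  one summand survives the truncation at 0.\<close>

lemma ennreal_abs_diff_hinge:
  fixes x y s :: real
  assumes "0 \<le> s"
  shows "ennreal (\<bar>x - y\<bar> - s) = ennreal (x - y - s) + ennreal (y - x - s)"
  using assms by (cases "x \<le> y") (auto simp: ennreal_neg algebra_simps abs_if)

section \<open>Optimality of comonotone pairs for power costs\<close>

context prob_space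
begin

text \<open>Each hinge cost is an integral of joint tail probabilities, and the comonotone pair
  minimises every one of them. For p > 1, mixing over \<open>s\<close> with a nonnegative weight
  preserves the inequality; for p = 1 the cost is the hinge at s = 0. Nonnegative integrals make the
  comparison meaningful for infinite costs too.\<close>

lemma comonotone_optimal:
  fixes A B Y' T :: "'a \<Rightarrow> real"
  assumes p: "1 \<le> p"
    and [measurable]: "A \<in> borel_measurable M" "B \<in> borel_measurable M"
      "Y' \<in> borel_measurable M" "T \<in> borel_measurable M"
    and cdf: "cdf (distr M borel A) = F" "cdf (distr M borel B) = G"
    and comonotone:
      "\<And>s t. prob {\<omega> \<in> space M. T \<omega> \<le> s \<and> t < Y' \<omega>} = max 0 (G s - F t)"
      "\<And>s t. prob {\<omega> \<in> space M. Y' \<omega> \<le> s \<and> t < T \<omega>} = max 0 (F s - G t)"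
  shows "(\<integral>\<^sup>+\<omega>. ennreal (\<bar>Y' \<omega> - T \<omega>\<bar> powr p) \<partial>M) \<le> (\<integral>\<^sup>+\<omega>. ennreal (\<bar>A \<omega> - B \<omega>\<bar> powr p) \<partial>M)"
proof -
  have hinge: "(\<integral>\<^sup>+\<omega>. ennreal (\<bar>Y' \<omega> - T \<omega>\<bar> - s) \<partial>M) \<le> (\<integral>\<^sup>+\<omega>. ennreal (\<bar>A \<omega> - B \<omega>\<bar> - s) \<partial>M)"
    if s: "0 \<le> s" for s
  proof -
    have "prob {\<omega> \<in> space M. T \<omega> \<le> t - s \<and> t < Y' \<omega>} \<le> prob {\<omega> \<in> space M. B \<omega> \<le> t - s \<and> t < A \<omega>}" for t
      using prob_le_and_gt_ge[of A B "t - s" t] by (simp add: comonotone cdf)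
    moreover have "prob {\<omega> \<in> space M. Y' \<omega> \<le> t - s \<and> t < T \<omega>} \<le> prob {\<omega> \<in> space M. A \<omega> \<le> t - s \<and> t < B \<omega>}" for t
      using prob_le_and_gt_ge[of B A "t - s" t] by (simp add: comonotone cdf)
    ultimately show ?thesis
      by (simp add: ennreal_abs_diff_hinge[OF s] nn_integral_add nn_integral_hinge emeasure_eq_measure
          add_mono nn_integral_mono ennreal_leI)
  qed
  show ?thesis
  proof (cases "p = 1")
    case True
    then show ?thesis using hinge[of 0] by simp
  next
    case False
    then have p: "1 < p" using p by simp
    interpret pair_sigma_finite M lborel
      by (intro pair_sigma_finite.intro sigma_finite_measure_axioms sigma_finite_lborel)
    define w where "w s = ennreal (indicator {0..} s * (p * (p - 1) * s powr (p - 2)))" for s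
    have [measurable]: "w \<in> borel_measurable borel"
      unfolding w_def by measurable
    have mix: "(\<integral>\<^sup>+\<omega>. ennreal (\<bar>C \<omega> - D \<omega>\<bar> powr p) \<partial>M)
        = (\<integral>\<^sup>+s. w s * (\<integral>\<^sup>+\<omega>. ennreal (\<bar>C \<omega> - D \<omega>\<bar> - s) \<partial>M) \<partial>lborel)"
      if [measurable]: "C \<in> borel_measurable M" "D \<in> borel_measurable M" for C D :: "'a \<Rightarrow> real"
    proof -
      have "(\<integral>\<^sup>+\<omega>. ennreal (\<bar>C \<omega> - D \<omega>\<bar> powr p) \<partial>M)
          = (\<integral>\<^sup>+\<omega>. (\<integral>\<^sup>+s. w s * ennreal (\<bar>C \<omega> - D \<omega>\<bar> - s) \<partial>lborel) \<partial>M)"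
        unfolding w_def by (intro nn_integral_cong powr_eq_nn_integral_hinge[OF p]) simp
      also have "\<dots> = (\<integral>\<^sup>+s. (\<integral>\<^sup>+\<omega>. w s * ennreal (\<bar>C \<omega> - D \<omega>\<bar> - s) \<partial>M) \<partial>lborel)"
        by (rule Fubini'[symmetric]) measurable
      finally show ?thesis by (simp add: nn_integral_cmult)
    qed
    show ?thesis
      unfolding mix[OF assms(4,5)] mix[OF assms(2,3)]
    proof (rule nn_integral_mono)
      fix s
      show "w s * (\<integral>\<^sup>+\<omega>. ennreal (\<bar>Y' \<omega> - T \<omega>\<bar> - s) \<partial>M) \<le> w s * (\<integral>\<^sup>+\<omega>. ennreal (\<bar>A \<omega> - B \<omega>\<bar> - s) \<partial>M)"
        using hinge[of s] by (cases "0 \<le> s") (auto simp: w_def intro: mult_left_mono)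
    qed
  qed
qed

end

section \<open>The norms\<close>

lemma lnorm_nonneg: "0 \<le> lnorm a n x"
  unfolding lnorm_def by (auto intro: Max_ge)

lemma lnorm_one: "lnorm (ereal 1) n x = (\<Sum>i<n. \<bar>x i\<bar>)"
  by (simp add: lnorm_def sum_nonneg)

lemma lnorm_powr: "0 < a \<Longrightarrow> lnorm (ereal a) n x powr a = (\<Sum>i<n. \<bar>x i\<bar> powr a)"
  by (simp add: lnorm_def powr_powr sum_nonneg)

lemma lnorm_cmult:
  assumes "0 < a"
  shows "lnorm (ereal a) n (\<lambda>i. c * x i) = \<bar>c\<bar> * lnorm (ereal a) n x"
  using assms by (simp add: lnorm_def abs_mult powr_mult powr_powr sum_nonneg flip: sum_distrib_left)

lemma lnorm_component_le:
  assumes "0 < a" "i < n"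
  shows "\<bar>x i\<bar> \<le> lnorm (ereal a) n x"
proof -
  have "\<bar>x i\<bar> powr a \<le> lnorm (ereal a) n x powr a"
    unfolding lnorm_powr[OF assms(1)] using assms(2) by (intro member_le_sum) auto
  then show ?thesis
    using powr_less_mono2[OF assms(1) lnorm_nonneg, of "ereal a" n x "\<bar>x i\<bar>"] by linarith
qed

text \<open>With \<open>S\<close> the sum on the right, each summand splits as |x i| times a power a
  - 1 of |x i|, and the second factor is at most that power of \<open>S\<close>.\<close>

lemma lnorm_le_sum_abs:
  assumes "1 \<le> a"
  shows "lnorm (ereal a) n x \<le> (\<Sum>i<n. \<bar>x i\<bar>)"
proof -
  define S where "S = (\<Sum>i<n. \<bar>x i\<bar>)"
  have S: "0 \<le> S" "\<And>i. i < n \<Longrightarrow> \<bar>x i\<bar> \<le> S"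
    unfolding S_def by (auto intro: sum_nonneg member_le_sum)
  have "(\<Sum>i<n. \<bar>x i\<bar> powr a) \<le> (\<Sum>i<n. \<bar>x i\<bar> * S powr (a - 1))"
  proof (rule sum_mono)
    fix i assume "i \<in> {..<n}"
    then have "\<bar>x i\<bar> * \<bar>x i\<bar> powr (a - 1) \<le> \<bar>x i\<bar> * S powr (a - 1)"
      using S assms by (intro mult_left_mono powr_mono2) auto
    then show "\<bar>x i\<bar> powr a \<le> \<bar>x i\<bar> * S powr (a - 1)"
      by (simp add: powr_mult_base)
  qed
  also have "\<dots> = S powr a"
    using S by (simp add: S_def powr_mult_base flip: sum_distrib_right)
  finally have "(\<Sum>i<n. \<bar>x i\<bar> powr a) powr (1/a) \<le> (S powr a) powr (1/a)"
    using assms by (intro powr_mono2) (auto intro: sum_nonneg)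
  then show ?thesis
    using assms S by (simp add: lnorm_def powr_powr flip: S_def)
qed

text \<open>Since \<open>a\<close> is finite, 1/a is positive and b = 1 is impossible; infinite
  \<open>b\<close> forces a = 1, and finite \<open>b\<close> excludes it.\<close>

lemma conjugate_exponents_cases:
  assumes "1 \<le> a" "1 \<le> b" "1 / ereal a + 1 / b = 1"
  obtains "a = 1" "b = \<infinity>" | r where "1 < a" "1 < r" "b = ereal r" "1 / a + 1 / r = 1"
proof (cases b)
  case (real r)
  then have r: "1 \<le> r" "1 / a + 1 / r = 1"
    using assms by (auto simp: one_ereal_def)
  have "a \<noteq> 1" "r \<noteq> 1" using r assms(1) by (auto simp: field_simps)
  then show thesis using that(2)[of r] r real assms(1) by simp
next
  case PInf
  then have "a = 1" using assms by (simp add: one_ereal_def)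
  then show thesis using that(1) PInf by simp
next
  case MInf
  then show thesis using assms by simp
qed

lemma abs_le_lnorm_infinity: "i < n \<Longrightarrow> \<bar>x i\<bar> \<le> lnorm \<infinity> n x"
  unfolding lnorm_def by (auto intro!: Max_ge)

text \<open>For a = 1 each |y i| is bounded by the maximum norm. Otherwise both vectors are scaled
  to norm one and Young's inequality is summed over the coordinates; a vector of norm 0 is treated
  apart because it cannot be scaled.\<close>

lemma lnorm_Holder:
  assumes ab: "1 \<le> a" "1 \<le> b" "1 / ereal a + 1 / b = 1"
  shows "\<bar>\<Sum>i<n. y i * x i\<bar> \<le> lnorm b n y * lnorm (ereal a) n x"
  using ab
proof (cases rule: conjugate_exponents_cases)
  case 1
  have "\<bar>\<Sum>i<n. y i * x i\<bar> \<le> (\<Sum>i<n. \<bar>y i\<bar> * \<bar>x i\<bar>)"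
    using sum_abs[of "\<lambda>i. y i * x i" "{..<n}"] by (simp add: abs_mult)
  also have "\<dots> \<le> (\<Sum>i<n. lnorm \<infinity> n y * \<bar>x i\<bar>)"
    by (intro sum_mono mult_right_mono abs_le_lnorm_infinity) auto
  finally show ?thesis
    using 1 by (simp add: lnorm_one flip: sum_distrib_left)
next
  case (2 r)
  define A where "A = lnorm (ereal a) n x"
  define B where "B = lnorm b n y"
  have le: "\<bar>x i\<bar> \<le> A" "\<bar>y i\<bar> \<le> B" if "i < n" for i
    using that 2 by (auto simp: A_def B_def intro: lnorm_component_le)
  have nn: "0 \<le> A" "0 \<le> B" by (simp_all add: A_def B_def lnorm_nonneg)
  show ?thesis
  proof (cases "A = 0 \<or> B = 0")
    case True
    then have "y i * x i = 0" if "i < n" for i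
      using le[OF that] by auto
    then have "(\<Sum>i<n. y i * x i) = 0" by (intro sum.neutral) auto
    then show ?thesis using nn by (simp add: A_def B_def)
  next
    case False
    then have pos: "0 < A" "0 < B" using nn by auto
    have "\<bar>\<Sum>i<n. y i * x i\<bar> \<le> (\<Sum>i<n. \<bar>x i\<bar> * \<bar>y i\<bar>)"
      using sum_abs[of "\<lambda>i. y i * x i" "{..<n}"] by (simp add: abs_mult mult.commute)
    also have "\<dots> = A * B * (\<Sum>i<n. (\<bar>x i\<bar> / A) * (\<bar>y i\<bar> / B))"
      using pos by (simp add: sum_distrib_left)
    also have "\<dots> \<le> A * B * (\<Sum>i<n. (\<bar>x i\<bar> / A) powr a / a + (\<bar>y i\<bar> / B) powr r / r)"
      using pos 2 by (intro mult_left_mono sum_mono Youngs_inequality) auto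
    also have "(\<Sum>i<n. (\<bar>x i\<bar> / A) powr a / a + (\<bar>y i\<bar> / B) powr r / r)
        = (\<Sum>i<n. \<bar>x i\<bar> powr a) / A powr a / a + (\<Sum>i<n. \<bar>y i\<bar> powr r) / B powr r / r"
      using pos by (simp add: powr_divide sum.distrib flip: sum_divide_distrib)
    also have "(\<Sum>i<n. \<bar>x i\<bar> powr a) = A powr a"
      using lnorm_powr[of a n x] 2 by (simp add: A_def)
    also have "(\<Sum>i<n. \<bar>y i\<bar> powr r) = B powr r"
      using lnorm_powr[of r n y] 2 by (simp add: B_def)
    also have "A powr a / A powr a / a + B powr r / B powr r / r = 1"
      using 2 pos by simp
    finally show ?thesis using pos by (simp add: A_def B_def mult.commute)
  qed
qed

lemma lnorm_dual_vector:
  assumes ab: "1 \<le> a" "1 \<le> b" "1 / ereal a + 1 / b = 1" and pos: "0 < lnorm b n y"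
  obtains d where "(\<Sum>i<n. y i * d i) = lnorm b n y" "lnorm (ereal a) n d = 1"
  using ab
proof (cases rule: conjugate_exponents_cases)
  case 1
  let ?S = "insert 0 ((\<lambda>i. \<bar>y i\<bar>) ` {..<n})"
  have "Max ?S \<in> ?S" by (intro Max_in) auto
  then obtain j where j: "j < n" "\<bar>y j\<bar> = lnorm b n y"
    using pos 1 by (auto simp: lnorm_def)
  \<comment> \<open>A signed unit vector at a coordinate \<open>j\<close> where the maximum norm is
    attained.\<close>
  define d where "d i = (if i = j then sgn (y j) else 0)" for i
  have "(\<Sum>i<n. y i * d i) = y j * sgn (y j)"
    using j by (simp add: d_def if_distrib cong: if_cong)
  also have "\<dots> = lnorm b n y" using j by (simp add: abs_sgn)
  finally have "(\<Sum>i<n. y i * d i) = lnorm b n y" .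
  moreover have "(\<Sum>i<n. \<bar>d i\<bar>) = 1"
    using j pos by (simp add: d_def if_distrib[of abs] abs_sgn_eq cong: if_cong)
  ultimately show thesis using that[of d] 1 by (simp add: lnorm_one)
next
  case (2 r)
  define B where "B = lnorm b n y"
  have B: "0 < B" using pos by (simp add: B_def)
  have Br: "B powr r = (\<Sum>i<n. \<bar>y i\<bar> powr r)"
    using lnorm_powr[of r n y] 2 by (simp add: B_def)
  have ra: "(r - 1) * a = r" using 2 by (simp add: field_simps)
  \<comment> \<open>The equality case of Hoelder: because (r - 1) * a = r, the a-th powers of the
    entries of \<open>d\<close> are proportional to the r-th powers of those of \<open>y\<close>,
    and the denominator normalises their sum to 1.\<close>
  define d where "d i = sgn (y i) * \<bar>y i\<bar> powr (r - 1) / B powr (r - 1)" for i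
  have "y i * d i = \<bar>y i\<bar> powr r / B powr (r - 1)" for i
  proof -
    have "y i * d i = \<bar>y i\<bar> * \<bar>y i\<bar> powr (r - 1) / B powr (r - 1)"
      by (simp add: d_def abs_sgn mult_ac)
    then show ?thesis by (simp add: powr_mult_base)
  qed
  then have "(\<Sum>i<n. y i * d i) = B powr r / B powr (r - 1)"
    by (simp add: Br flip: sum_divide_distrib)
  also have "\<dots> = B" using B by (simp flip: powr_diff)
  finally have "(\<Sum>i<n. y i * d i) = lnorm b n y" by (simp add: B_def)
  moreover have "lnorm (ereal a) n d = 1"
  proof -
    have "\<bar>d i\<bar> powr a = \<bar>y i\<bar> powr r / B powr r" for i
    proof (cases "y i = 0")
      case False
      then have "\<bar>d i\<bar> = \<bar>y i\<bar> powr (r - 1) / B powr (r - 1)"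
        by (simp add: d_def abs_mult abs_sgn_eq)
      then show ?thesis by (simp add: powr_divide powr_powr ra)
    qed (simp add: d_def)
    then have "(\<Sum>i<n. \<bar>d i\<bar> powr a) = 1"
      using B by (simp add: Br[symmetric] flip: sum_divide_distrib)
    then show ?thesis by (simp add: lnorm_def)
  qed
  ultimately show thesis by (rule that)
qed

lemma sum_lessThan_split_block:
  fixes f :: "nat \<Rightarrow> real"
  assumes "m \<le> n"
  shows "(\<Sum>i<n. f i) = (\<Sum>i<m. f i) + (\<Sum>j<n - m. f (m + j))"
proof -
  have "(\<Sum>i<n. f i) = (\<Sum>i<m. f i) + (\<Sum>i=m..<n. f i)"
    using assms by (simp add: sum.atLeastLessThan_concat lessThan_atLeast0)
  also have "(\<Sum>i=m..<n. f i) = (\<Sum>j<n - m. f (m + j))"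
    using assms sum.shift_bounds_nat_ivl[of f 0 m "n - m"] by (simp add: lessThan_atLeast0 add.commute)
  finally show ?thesis .
qed

lemma lnorm_zero_extension:
  assumes "m \<le> n" "0 < a"
  shows "lnorm (ereal a) n (\<lambda>i. if i < m then 0 else d (i - m)) = lnorm (ereal a) (n - m) d"
  using assms by (simp add: lnorm_def sum_lessThan_split_block)

section \<open>Integrable variables and Wasserstein distances\<close>

lemma Lp_bound:
  assumes p: "1 \<le> p" and [measurable]: "f \<in> borel_measurable M"
    and h: "h \<in> Lp M p" and le: "\<And>\<omega>. \<omega> \<in> space M \<Longrightarrow> \<bar>f \<omega>\<bar> \<le> \<bar>h \<omega>\<bar>"
  shows "f \<in> Lp M p"
proof -
  have "integrable M (\<lambda>\<omega>. \<bar>f \<omega>\<bar> powr p)"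
  proof (rule Bochner_Integration.integrable_bound)
    show "integrable M (\<lambda>\<omega>. \<bar>h \<omega>\<bar> powr p)" using h by (simp add: Lp_def)
    show "AE \<omega> in M. norm (\<bar>f \<omega>\<bar> powr p) \<le> norm (\<bar>h \<omega>\<bar> powr p)"
      using le p by (intro AE_I2) (simp add: powr_mono2)
  qed measurable
  then show ?thesis by (simp add: Lp_def)
qed

lemma Lp_add:
  assumes p: "1 \<le> p" and f: "f \<in> Lp M p" and h: "h \<in> Lp M p"
  shows "(\<lambda>\<omega>. f \<omega> + h \<omega>) \<in> Lp M p"
proof -
  have [measurable]: "f \<in> borel_measurable M" "h \<in> borel_measurable M"
    using f h by (simp_all add: Lp_def)
  have "integrable M (\<lambda>\<omega>. \<bar>f \<omega> + h \<omega>\<bar> powr p)"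
  proof (rule Bochner_Integration.integrable_bound)
    show "integrable M (\<lambda>\<omega>. 2 powr p * (\<bar>f \<omega>\<bar> powr p + \<bar>h \<omega>\<bar> powr p))"
      using f h by (simp add: Lp_def)
    have "\<bar>x + y\<bar> powr p \<le> 2 powr p * (\<bar>x\<bar> powr p + \<bar>y\<bar> powr p)" for x y :: real
    proof -
      have "\<bar>x + y\<bar> powr p \<le> (2 * max \<bar>x\<bar> \<bar>y\<bar>) powr p"
        using p by (intro powr_mono2) auto
      also have "\<dots> = 2 powr p * max \<bar>x\<bar> \<bar>y\<bar> powr p"
        by (simp add: powr_mult)
      also have "\<dots> \<le> 2 powr p * (\<bar>x\<bar> powr p + \<bar>y\<bar> powr p)"
        by (intro mult_left_mono) (auto simp: max_def)
      finally show ?thesis .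
    qed
    then show "AE \<omega> in M. norm (\<bar>f \<omega> + h \<omega>\<bar> powr p)
        \<le> norm (2 powr p * (\<bar>f \<omega>\<bar> powr p + \<bar>h \<omega>\<bar> powr p))"
      by (intro AE_I2) simp
  qed measurable
  then show ?thesis by (simp add: Lp_def)
qed

lemma Lp_cmult:
  assumes "f \<in> Lp M p"
  shows "(\<lambda>\<omega>. c * f \<omega>) \<in> Lp M p"
  using assms by (auto simp: Lp_def abs_mult powr_mult)

lemma Lp_diff:
  assumes "1 \<le> p" "f \<in> Lp M p" "h \<in> Lp M p"
  shows "(\<lambda>\<omega>. f \<omega> - h \<omega>) \<in> Lp M p"
  using Lp_add[OF assms(1,2) Lp_cmult[OF assms(3), of "-1"]] by simp

lemma Lp_abs: "f \<in> Lp M p \<Longrightarrow> (\<lambda>\<omega>. \<bar>f \<omega>\<bar>) \<in> Lp M p"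
  by (auto simp: Lp_def)

lemma Lp_sum:
  assumes "1 \<le> p" "\<And>i. i \<in> I \<Longrightarrow> f i \<in> Lp M p"
  shows "(\<lambda>\<omega>. \<Sum>i\<in>I. f i \<omega>) \<in> Lp M p"
  using assms(2)
proof (induction I rule: infinite_finite_induct)
  case (insert i I)
  then show ?case using Lp_add[OF assms(1), of "f i" M "\<lambda>\<omega>. \<Sum>i\<in>I. f i \<omega>"] by simp
qed (simp_all add: Lp_def)

text \<open>Finiteness of the p-th moment depends on the law alone. Hence both halves of any
  coupling of p-integrable laws are p-integrable.\<close>

lemma Lp_cong_distr:
  assumes [measurable]: "A \<in> borel_measurable M" and Y: "Y \<in> Lp M p"
    and eq: "distr M borel A = distr M borel Y"
  shows "A \<in> Lp M p"
proof -
  have [measurable]: "Y \<in> borel_measurable M" using Y by (simp add: Lp_def)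
  have "integrable (distr M borel Y) (\<lambda>x. \<bar>x\<bar> powr p)"
    using Y by (subst integrable_distr_eq) (auto simp: Lp_def)
  then have "integrable M (\<lambda>\<omega>. \<bar>A \<omega>\<bar> powr p)"
    unfolding eq[symmetric] by (subst (asm) integrable_distr_eq) auto
  then show ?thesis by (simp add: Lp_def)
qed

section \<open>Attainment of the Wasserstein distance on the real line\<close>

context prob_space
begin

lemma distr_eq_of_cdf_eq:
  assumes "A \<in> borel_measurable M" "Y \<in> borel_measurable M"
    and "cdf (distr M borel A) = cdf (distr M borel Y)"
  shows "distr M borel A = distr M borel Y"
  using assms by (intro cdf_unique real_distribution_distr) auto

text \<open>The second half of the coupling is the given \<open>T\<close> and not a mere copy of it,
  so that when \<open>T\<close> is a function of a random vector the coupling can be lifted to that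
  vector.\<close>

lemma wasserstein_attained:
  fixes T V Y :: "'a \<Rightarrow> real"
  assumes p: "1 \<le> p" and T: "T \<in> Lp M p" and Y: "Y \<in> Lp M p"
    and V: "V \<in> borel_measurable M" "\<And>\<omega>. 0 \<le> V \<omega>" "\<And>\<omega>. V \<omega> \<le> 3/2"
    and atomless: "\<And>u. prob {\<omega> \<in> space M. V \<omega> = u} = 0"
  obtains Y' :: "'a \<Rightarrow> real" where
    "Y' \<in> Lp M p" "distr M borel Y' = distr M borel Y"
    "(\<integral>\<omega>. \<bar>Y' \<omega> - T \<omega>\<bar> powr p \<partial>M) powr (1 / p)
      \<le> wasserstein M p (cdf (distr M borel Y)) (cdf (distr M borel T))"
proof -
  have [measurable]: "T \<in> borel_measurable M" "Y \<in> borel_measurable M"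
    using T Y by (simp_all add: Lp_def)
  obtain Y' where Y'_meas [measurable]: "Y' \<in> borel_measurable M"
    and distr: "distr M borel Y' = distr M borel Y"
    and comonotone: "\<And>s t. prob {\<omega> \<in> space M. T \<omega> \<le> s \<and> t < Y' \<omega>}
        = max 0 (cdf (distr M borel T) s - cdf (distr M borel Y) t)"
      "\<And>s t. prob {\<omega> \<in> space M. Y' \<omega> \<le> s \<and> t < T \<omega>}
        = max 0 (cdf (distr M borel Y) s - cdf (distr M borel T) t)"
    by (rule exists_comonotone[OF \<open>T \<in> borel_measurable M\<close> V(1) \<open>Y \<in> borel_measurable M\<close> V(2,3) atomless])
      blast
  have Y': "Y' \<in> Lp M p" by (rule Lp_cong_distr[OF _ Y distr]) measurable
  \<comment> \<open>Optimality is stated with nonnegative integrals, the distance with Bochner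
    integrals, which are 0 on non-integrable functions. The two agree because all variables involved
    have finite p-th moments.\<close>
  have nn: "ennreal (\<integral>\<omega>. \<bar>C \<omega> - D \<omega>\<bar> powr p \<partial>M) = (\<integral>\<^sup>+\<omega>. ennreal (\<bar>C \<omega> - D \<omega>\<bar> powr p) \<partial>M)"
    if "C \<in> Lp M p" "D \<in> Lp M p" for C D
    using Lp_diff[OF p that] by (intro nn_integral_eq_integral[symmetric]) (auto simp: Lp_def)
  have "(\<integral>\<omega>. \<bar>Y' \<omega> - T \<omega>\<bar> powr p \<partial>M) powr (1 / p)
      \<le> wasserstein M p (cdf (distr M borel Y)) (cdf (distr M borel T))"
    unfolding wasserstein_def
  proof (rule cInf_greatest)
    fix c assume "c \<in> {(\<integral>\<omega>. \<bar>A \<omega> - B \<omega>\<bar> powr p \<partial>M) powr (1 / p) |A B.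
        A \<in> borel_measurable M \<and> B \<in> borel_measurable M \<and>
        cdf (distr M borel A) = cdf (distr M borel Y) \<and> cdf (distr M borel B) = cdf (distr M borel T)}"
    then obtain A B where c: "c = (\<integral>\<omega>. \<bar>A \<omega> - B \<omega>\<bar> powr p \<partial>M) powr (1 / p)"
      and [measurable]: "A \<in> borel_measurable M" "B \<in> borel_measurable M"
      and eq: "cdf (distr M borel A) = cdf (distr M borel Y)" "cdf (distr M borel B) = cdf (distr M borel T)"
      by blast
    have "A \<in> Lp M p"
      by (rule Lp_cong_distr[OF _ Y distr_eq_of_cdf_eq[OF _ _ eq(1)]]) measurable
    moreover have "B \<in> Lp M p"
      by (rule Lp_cong_distr[OF _ T distr_eq_of_cdf_eq[OF _ _ eq(2)]]) measurable
    moreover have "(\<integral>\<^sup>+\<omega>. ennreal (\<bar>Y' \<omega> - T \<omega>\<bar> powr p) \<partial>M) \<le> (\<integral>\<^sup>+\<omega>. ennreal (\<bar>A \<omega> - B \<omega>\<bar> powr p) \<partial>M)"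
      by (rule comonotone_optimal[OF p _ _ _ _ eq comonotone]) measurable
    ultimately have "(\<integral>\<omega>. \<bar>Y' \<omega> - T \<omega>\<bar> powr p \<partial>M) \<le> (\<integral>\<omega>. \<bar>A \<omega> - B \<omega>\<bar> powr p \<partial>M)"
      using Y' T by (simp add: nn[symmetric])
    then show "(\<integral>\<omega>. \<bar>Y' \<omega> - T \<omega>\<bar> powr p \<partial>M) powr (1 / p) \<le> c"
      unfolding c using p by (intro powr_mono2) auto
  qed (use \<open>T \<in> borel_measurable M\<close> \<open>Y \<in> borel_measurable M\<close> in blast)
  with Y' distr show thesis by (rule that)
qed

end

lemma wasserstein_le:
  assumes "A \<in> borel_measurable M" "B \<in> borel_measurable M"
    and "cdf (distr M borel A) = F" "cdf (distr M borel B) = G"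
  shows "wasserstein M p F G \<le> (\<integral>\<omega>. \<bar>A \<omega> - B \<omega>\<bar> powr p \<partial>M) powr (1 / p)"
  unfolding wasserstein_def
  by (rule cInf_lower) (use assms in \<open>auto intro!: bdd_belowI[of _ 0]\<close>)

lemma wasserstein_vec_le:
  assumes "X \<in> M \<rightarrow>\<^sub>M borel_Rn n" "Y \<in> M \<rightarrow>\<^sub>M borel_Rn n"
  shows "wasserstein_vec M a p n (cdf_vec M n X) (cdf_vec M n Y)
    \<le> (\<integral>\<omega>. lnorm (ereal a) n (\<lambda>i. X \<omega> i - Y \<omega> i) powr p \<partial>M) powr (1 / p)"
  unfolding wasserstein_vec_def
  by (rule cInf_lower) (use assms in \<open>auto intro!: bdd_belowI[of _ 0]\<close>)

section \<open>Random vectors\<close>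

lemma lnorm_cong: "(\<And>i. i < n \<Longrightarrow> x i = y i) \<Longrightarrow> lnorm (ereal a) n x = lnorm (ereal a) n y"
  by (simp add: lnorm_def)

lemma measurable_lnorm [measurable (raw)]:
  assumes "\<And>i. i < n \<Longrightarrow> (\<lambda>\<omega>. x \<omega> i) \<in> borel_measurable M"
  shows "(\<lambda>\<omega>. lnorm (ereal a) n (x \<omega>)) \<in> borel_measurable M"
  unfolding lnorm_def using assms by simp

lemma borel_Rn_component_measurable:
  "X \<in> M \<rightarrow>\<^sub>M borel_Rn n \<Longrightarrow> i < n \<Longrightarrow> (\<lambda>\<omega>. X \<omega> i) \<in> borel_measurable M"
  by (rule measurable_compose[OF _ measurable_borel_Rn_component])

lemma lnorm_in_Lp:
  assumes p: "1 \<le> p" and a: "1 \<le> a" and x: "\<And>i. i < n \<Longrightarrow> (\<lambda>\<omega>. x \<omega> i) \<in> Lp M p"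
  shows "(\<lambda>\<omega>. lnorm (ereal a) n (x \<omega>)) \<in> Lp M p"
proof (rule Lp_bound[OF p])
  show "(\<lambda>\<omega>. lnorm (ereal a) n (x \<omega>)) \<in> borel_measurable M"
    using x by (intro measurable_lnorm) (auto simp: Lp_def)
  show "(\<lambda>\<omega>. \<Sum>i<n. \<bar>x \<omega> i\<bar>) \<in> Lp M p"
    using x by (intro Lp_sum[OF p] Lp_abs) auto
  show "\<bar>lnorm (ereal a) n (x \<omega>)\<bar> \<le> \<bar>\<Sum>i<n. \<bar>x \<omega> i\<bar>\<bar>" for \<omega>
    using lnorm_le_sum_abs[OF a, of n "x \<omega>"] lnorm_nonneg[of "ereal a" n "x \<omega>"] by (simp add: sum_nonneg)
qed

text \<open>The norm dominates each coordinate and is dominated by the sum of their absolute values,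
  so integrability of vectors reduces to the univariate case.\<close>

lemma Lp_vec_iff:
  assumes p: "1 \<le> p" and a: "1 \<le> a"
  shows "X \<in> Lp_vec M a p n \<longleftrightarrow> X \<in> M \<rightarrow>\<^sub>M borel_Rn n \<and> (\<forall>i<n. (\<lambda>\<omega>. X \<omega> i) \<in> Lp M p)"
proof (intro iffI conjI allI impI)
  fix i assume X: "X \<in> Lp_vec M a p n" and i: "i < n"
  then have m: "X \<in> M \<rightarrow>\<^sub>M borel_Rn n" by (simp add: Lp_vec_def)
  have "(\<lambda>\<omega>. lnorm (ereal a) n (X \<omega>)) \<in> Lp M p"
    using X borel_Rn_component_measurable[OF m] by (auto simp: Lp_def Lp_vec_def lnorm_nonneg intro: measurable_lnorm)
  then show "(\<lambda>\<omega>. X \<omega> i) \<in> Lp M p"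
  proof (rule Lp_bound[OF p borel_Rn_component_measurable[OF m i]])
    show "\<bar>X \<omega> i\<bar> \<le> \<bar>lnorm (ereal a) n (X \<omega>)\<bar>" for \<omega>
      using lnorm_component_le[of a i n "X \<omega>"] a i by simp
  qed
next
  assume "X \<in> M \<rightarrow>\<^sub>M borel_Rn n \<and> (\<forall>i<n. (\<lambda>\<omega>. X \<omega> i) \<in> Lp M p)"
  then show "X \<in> Lp_vec M a p n"
    using lnorm_in_Lp[OF p a, of n X M] by (simp add: Lp_def Lp_vec_def lnorm_nonneg)
qed (simp add: Lp_vec_def)

text \<open>Closed lower half-lines generate the Borel sets of the line, and countably many of them
  cover it; therefore their products, the sets measured by \<open>cdf_vec\<close>, generate the
  product sigma-algebra.\<close>

lemma borel_Rn_eq_sigma_sets: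
  "sets (borel_Rn n) = sigma_sets (Rn n) (range (\<lambda>b. {x \<in> Rn n. \<forall>i<n. x i \<le> b i}))"
proof -
  define P where "P = {{f \<in> Rn n. \<forall>i\<in>j. f i \<in> A i} | A j. j \<in> {{..<n}} \<and> A \<in> Pi j (\<lambda>_. range (\<lambda>c::real. {..c}))}"
  have "sets (\<Pi>\<^sub>M i\<in>{..<n}. sigma UNIV (range (\<lambda>c::real. {..c}))) = sets (sigma (Rn n) P)"
    unfolding P_def Rn_def
  proof (rule sets_PiM_sigma)
    have "UNIV = (\<Union>k::nat. {..real k})"
      using real_arch_simple by auto
    then show "\<exists>S\<subseteq>range (\<lambda>c::real. {..c}). countable S \<and> UNIV = \<Union>S" for i
      by (intro exI[of _ "range (\<lambda>k::nat. {..real k})"]) auto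
  qed auto
  also have "P = range (\<lambda>b. {x \<in> Rn n. \<forall>i<n. x i \<le> b i})"
  proof (intro equalityI subsetI)
    fix S assume "S \<in> P"
    then obtain A where S: "S = {f \<in> Rn n. \<forall>i\<in>{..<n}. f i \<in> A i}"
      and "A \<in> {..<n} \<rightarrow> range (\<lambda>c::real. {..c})"
      unfolding P_def by blast
    then have "\<forall>i\<in>{..<n}. \<exists>c. A i = {..c}" by blast
    then obtain b where "\<forall>i\<in>{..<n}. A i = {..b i}" by metis
    then have "S = {x \<in> Rn n. \<forall>i<n. x i \<le> b i}" unfolding S by auto
    then show "S \<in> range (\<lambda>b. {x \<in> Rn n. \<forall>i<n. x i \<le> b i})" by blast
  next
    fix S assume "S \<in> range (\<lambda>b. {x \<in> Rn n. \<forall>i<n. x i \<le> b i})"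
    then obtain b where "S = {x \<in> Rn n. \<forall>i\<in>{..<n}. x i \<in> {..b i}}" by auto
    then show "S \<in> P"
      unfolding P_def by (intro CollectI exI[of _ "\<lambda>i. {..b i}"] exI[of _ "{..<n}"]) auto
  qed
  finally show ?thesis
    unfolding borel_Rn_def borel_eq_atMost by (subst (asm) sets_measure_of) auto
qed

text \<open>The lower orthants are closed under intersection, by taking minima of corners, and those
  with corner (k, ..., k) exhaust the space. Uniqueness of measures on such a generator gives the
  claim.\<close>

lemma (in prob_space) distr_eq_of_cdf_vec_eq:
  assumes X [measurable]: "X \<in> M \<rightarrow>\<^sub>M borel_Rn n" and Y [measurable]: "Y \<in> M \<rightarrow>\<^sub>M borel_Rn n"
    and eq: "cdf_vec M n X = cdf_vec M n Y"
  shows "distr M (borel_Rn n) X = distr M (borel_Rn n) Y"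
proof -
  define box where "box b = {x \<in> Rn n. \<forall>i<n. x i \<le> b i}" for b :: "nat \<Rightarrow> real"
  have box: "sets (borel_Rn n) = sigma_sets (Rn n) (range box)"
    using borel_Rn_eq_sigma_sets[of n] by (simp add: box_def[abs_def])
  have emeasure_box: "emeasure (distr M (borel_Rn n) Z) (box b) = cdf_vec M n Z b"
    if [measurable]: "Z \<in> M \<rightarrow>\<^sub>M borel_Rn n" for Z b
  proof -
    have "box b \<in> sets (borel_Rn n)" unfolding box by auto
    then have "emeasure (distr M (borel_Rn n) Z) (box b) = emeasure M (Z -` box b \<inter> space M)"
      by (simp add: emeasure_distr)
    also have "Z -` box b \<inter> space M = {\<omega> \<in> space M. \<forall>i<n. Z \<omega> i \<le> b i}"
      using measurable_space[OF that] by (auto simp: box_def)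
    finally show ?thesis by (simp add: cdf_vec_def emeasure_eq_measure)
  qed
  show ?thesis
  proof (rule measure_eqI_generator_eq[where E="range box" and \<Omega>="Rn n" and A="\<lambda>k. box (\<lambda>i. real k)"])
    show "Int_stable (range box)"
    proof (rule Int_stableI_image)
      fix b c
      have "box b \<inter> box c = box (\<lambda>i. min (b i) (c i))" by (auto simp: box_def)
      then show "\<exists>k\<in>UNIV. box b \<inter> box c = box k" by blast
    qed
    show "(\<Union>k. box (\<lambda>i. real k)) = Rn n"
    proof (intro equalityI subsetI)
      fix x assume x: "x \<in> Rn n"
      obtain k :: nat where k: "(\<Sum>i<n. \<bar>x i\<bar>) \<le> real k" using real_arch_simple by blast
      have "x i \<le> real k" if "i < n" for i
      proof -
        have "\<bar>x i\<bar> \<le> (\<Sum>i<n. \<bar>x i\<bar>)" using that by (intro member_le_sum) auto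
        then show ?thesis using k by linarith
      qed
      then show "x \<in> (\<Union>k. box (\<lambda>i. real k))" using x by (auto simp: box_def)
    qed (auto simp: box_def)
    show "emeasure (distr M (borel_Rn n) X) S = emeasure (distr M (borel_Rn n) Y) S"
      if "S \<in> range box" for S
      using that eq X Y by (auto simp: emeasure_box)
    show "emeasure (distr M (borel_Rn n) X) (box (\<lambda>i. real k)) \<noteq> \<infinity>" for k
      using X by (simp add: emeasure_box)
  qed (auto simp: box box_def)
qed

lemma lipschitz_measurable:
  assumes a: "1 \<le> a" and f: "lipschitz_ineq a n f C"
  shows "f \<in> borel_measurable (borel_Rn n)"
proof -
  \<comment> \<open>\<open>h\<close> extends \<open>f\<close> to all functions on the naturals,
    where the product topology is available. The bound by finitely many coordinate differences makes
    it continuous there.\<close>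
  define h where "h x = f (restrict x {..<n})" for x :: "nat \<Rightarrow> real"
  have C: "0 \<le> C" using f by (simp add: lipschitz_ineq_def)
  have h: "\<bar>h y - h x\<bar> \<le> C * (\<Sum>i<n. \<bar>y i - x i\<bar>)" for x y
  proof -
    have "\<bar>h y - h x\<bar> \<le> C * lnorm (ereal a) n (\<lambda>i. restrict y {..<n} i - restrict x {..<n} i)"
    proof -
      have "restrict z {..<n} \<in> Rn n" for z by (simp add: Rn_def)
      then show ?thesis using f unfolding h_def lipschitz_ineq_def by blast
    qed
    also have "lnorm (ereal a) n (\<lambda>i. restrict y {..<n} i - restrict x {..<n} i)
        = lnorm (ereal a) n (\<lambda>i. y i - x i)"
      by (rule lnorm_cong) simp
    also have "C * \<dots> \<le> C * (\<Sum>i<n. \<bar>y i - x i\<bar>)"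
      by (intro mult_left_mono lnorm_le_sum_abs a C)
    finally show ?thesis .
  qed
  have "continuous_on UNIV h"
    unfolding continuous_on_def
  proof
    fix x
    have "continuous_on UNIV (\<lambda>y::nat \<Rightarrow> real. C * (\<Sum>i<n. \<bar>y i - x i\<bar>))"
      by (intro continuous_intros) simp
    then have "((\<lambda>y. C * (\<Sum>i<n. \<bar>y i - x i\<bar>)) \<longlongrightarrow> C * (\<Sum>i<n. \<bar>x i - x i\<bar>)) (at x)"
      unfolding continuous_on_def by (rule bspec) (rule UNIV_I)
    then have lim: "((\<lambda>y. C * (\<Sum>i<n. \<bar>y i - x i\<bar>)) \<longlongrightarrow> 0) (at x)" by simp
    have "\<forall>\<^sub>F y in at x. norm (h y - h x) \<le> C * (\<Sum>i<n. \<bar>y i - x i\<bar>)"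
      unfolding real_norm_def by (intro always_eventually allI h)
    then have "((\<lambda>y. h y - h x) \<longlongrightarrow> 0) (at x)"
      using lim by (rule Lim_null_comparison)
    then show "(h \<longlongrightarrow> h x) (at x)" by (rule LIM_zero_cancel)
  qed
  then have [measurable]: "h \<in> borel_measurable borel"
    by (rule borel_measurable_continuous_onI)
  \<comment> \<open>Filling with zeros maps \<open>Rn n\<close> measurably into the topological
    function space; since \<open>h\<close> ignores the coordinates from \<open>n\<close> on,
    composing with it gives \<open>f\<close> back.\<close>
  have "(\<lambda>x. if i < n then x i else 0) \<in> borel_measurable (borel_Rn n)" for i
    by (cases "i < n") simp_all
  then have [measurable]: "(\<lambda>x i. if i < n then x i else 0) \<in> borel_Rn n \<rightarrow>\<^sub>M borel"
    by (rule measurable_coordinatewise_then_product)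
  have *: "f x = h (\<lambda>i. if i < n then x i else 0)" if "x \<in> space (borel_Rn n)" for x
    unfolding h_def
  proof (intro arg_cong[where f=f] ext)
    show "x i = restrict (\<lambda>i. if i < n then x i else 0) {..<n} i" for i
      using that by (cases "i < n") (auto simp: Rn_def PiE_def extensional_def)
  qed
  have "(\<lambda>x. h (\<lambda>i. if i < n then x i else 0)) \<in> borel_measurable (borel_Rn n)"
    by measurable
  then show ?thesis
    by (subst measurable_cong[where M="borel_Rn n", OF *])
qed

section \<open>Comparison of the uncertainty sets\<close>

text \<open>The dual norm of \<open>\<beta>\<close> is itself a Lipschitz bound for
  \<open>g\<close>, so minimality of \<open>K\<close> applies. Hoelder handles the linear block. If
  a = 1, the norm is additive over the two blocks and \<open>L\<close> bounds the first; if m = 0,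
  the first block is constant.\<close>

lemma lipschitz_constant_le_dual_norm:
  assumes ab: "1 \<le> a" "1 \<le> b" "1 / ereal a + 1 / b = 1"
    and K: "is_lipschitz_constant a n g K" and dec: "linear_decomposition n m g gt \<beta>"
    and L: "is_lipschitz_constant a m gt L"
    and cases: "(a = 1 \<and> L \<le> lnorm \<infinity> (n - m) \<beta>) \<or> m = 0"
  shows "K \<le> lnorm b (n - m) \<beta>"
proof -
  let ?B = "lnorm b (n - m) \<beta>"
  have m: "m \<le> n" and g: "\<And>x. x \<in> Rn n \<Longrightarrow> g x = gt (restrict x {..<m}) + (\<Sum>i<n - m. \<beta> i * x (m + i))"
    using dec by (auto simp: linear_decomposition_def)
  have "lipschitz_ineq a n g ?B"
    unfolding lipschitz_ineq_def
  proof (intro conjI ballI lnorm_nonneg)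
    fix x y assume xy: "x \<in> Rn n" "y \<in> Rn n"
    let ?z = "\<lambda>i. x i - y i"
    have "(\<Sum>i<n - m. \<beta> i * ?z (m + i)) = (\<Sum>i<n - m. \<beta> i * x (m + i)) - (\<Sum>i<n - m. \<beta> i * y (m + i))"
      by (simp add: right_diff_distrib sum_subtractf)
    then have "\<bar>g x - g y\<bar> = \<bar>gt (restrict x {..<m}) - gt (restrict y {..<m})
        + (\<Sum>i<n - m. \<beta> i * ?z (m + i))\<bar>"
      using g[OF xy(1)] g[OF xy(2)] by (intro arg_cong[where f=abs]) linarith
    also have "\<dots> \<le> \<bar>gt (restrict x {..<m}) - gt (restrict y {..<m})\<bar>
        + ?B * lnorm (ereal a) (n - m) (\<lambda>i. ?z (m + i))"
      using lnorm_Holder[OF ab, where n="n - m" and y=\<beta> and x="\<lambda>i. ?z (m + i)"] by linarith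
    also have "\<dots> \<le> ?B * lnorm (ereal a) n ?z"
      using cases
    proof
      assume "m = 0"
      then show ?thesis by (simp add: restrict_def)
    next
      assume *: "a = 1 \<and> L \<le> lnorm \<infinity> (n - m) \<beta>"
      have b: "b = \<infinity>" using ab * by (cases rule: conjugate_exponents_cases) auto
      have "restrict z {..<m} \<in> Rn m" for z by (simp add: Rn_def)
      then have "\<bar>gt (restrict x {..<m}) - gt (restrict y {..<m})\<bar>
          \<le> L * lnorm (ereal a) m (\<lambda>i. restrict x {..<m} i - restrict y {..<m} i)"
        using L unfolding is_lipschitz_constant_def lipschitz_ineq_def by blast
      also have "lnorm (ereal a) m (\<lambda>i. restrict x {..<m} i - restrict y {..<m} i) = (\<Sum>i<m. \<bar>?z i\<bar>)"
        using * by (simp add: lnorm_one)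
      also have "L * \<dots> \<le> ?B * (\<Sum>i<m. \<bar>?z i\<bar>)"
        using * b by (intro mult_right_mono sum_nonneg) auto
      finally show ?thesis
        using * by (simp add: restrict_def lnorm_one sum_lessThan_split_block[OF m, of "\<lambda>i. \<bar>?z i\<bar>"] distrib_left)
    qed
    finally show "\<bar>g x - g y\<bar> \<le> ?B * lnorm (ereal a) n ?z" .
  qed
  then show ?thesis using K by (auto simp: is_lipschitz_constant_def)
qed

lemma uncertainty_mono: "\<epsilon> \<le> \<epsilon>' \<Longrightarrow> uncertainty M p \<epsilon> X \<subseteq> uncertainty M p \<epsilon>' X"
  by (auto simp: uncertainty_def)

context prob_space
begin

lemma cdf_distr_compose_eq:
  assumes X [measurable]: "X \<in> M \<rightarrow>\<^sub>M borel_Rn n" and Y [measurable]: "Y \<in> M \<rightarrow>\<^sub>M borel_Rn n"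
    and eq: "cdf_vec M n X = cdf_vec M n Y" and f [measurable]: "f \<in> borel_measurable (borel_Rn n)"
  shows "distr M borel (\<lambda>\<omega>. f (X \<omega>)) = distr M borel (\<lambda>\<omega>. f (Y \<omega>))"
  using distr_eq_of_cdf_vec_eq[OF X Y eq] distr_distr[OF f X] distr_distr[OF f Y]
  by (simp add: comp_def)

lemma Lp_vec_cong_cdf_vec:
  assumes pa: "1 \<le> p" "1 \<le> a" and A: "A \<in> M \<rightarrow>\<^sub>M borel_Rn n" and X: "X \<in> Lp_vec M a p n"
    and eq: "cdf_vec M n A = cdf_vec M n X"
  shows "A \<in> Lp_vec M a p n"
  unfolding Lp_vec_iff[OF pa]
proof (intro conjI allI impI)
  fix i assume i: "i < n"
  have X': "X \<in> M \<rightarrow>\<^sub>M borel_Rn n" "(\<lambda>\<omega>. X \<omega> i) \<in> Lp M p"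
    using X i by (auto simp: Lp_vec_iff[OF pa])
  show "(\<lambda>\<omega>. A \<omega> i) \<in> Lp M p"
    by (rule Lp_cong_distr[OF borel_Rn_component_measurable[OF A i] X'(2)
        cdf_distr_compose_eq[OF A X'(1) eq measurable_borel_Rn_component[OF i]]])
qed fact

lemma lipschitz_diff_in_Lp:
  assumes pa: "1 \<le> p" "1 \<le> a" and g: "lipschitz_ineq a n g K"
    and A: "A \<in> Lp_vec M a p n" and B: "B \<in> Lp_vec M a p n"
  shows "(\<lambda>\<omega>. lnorm (ereal a) n (\<lambda>i. A \<omega> i - B \<omega> i)) \<in> Lp M p"
    and "(\<lambda>\<omega>. g (A \<omega>) - g (B \<omega>)) \<in> Lp M p"
    and "(\<integral>\<omega>. \<bar>g (A \<omega>) - g (B \<omega>)\<bar> powr p \<partial>M) powr (1 / p)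
      \<le> K * (\<integral>\<omega>. lnorm (ereal a) n (\<lambda>i. A \<omega> i - B \<omega> i) powr p \<partial>M) powr (1 / p)"
proof -
  have A' [measurable]: "A \<in> M \<rightarrow>\<^sub>M borel_Rn n" and B' [measurable]: "B \<in> M \<rightarrow>\<^sub>M borel_Rn n"
    using A B by (simp_all add: Lp_vec_def)
  have [measurable]: "g \<in> borel_measurable (borel_Rn n)"
    by (rule lipschitz_measurable[OF pa(2) g])
  have K: "0 \<le> K" using g by (simp add: lipschitz_ineq_def)
  let ?l = "\<lambda>\<omega>. lnorm (ereal a) n (\<lambda>i. A \<omega> i - B \<omega> i)"
  show l: "?l \<in> Lp M p"
    using A B by (intro lnorm_in_Lp[OF pa]) (auto simp: Lp_vec_iff[OF pa] intro: Lp_diff[OF pa(1)])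
  have le: "\<bar>g (A \<omega>) - g (B \<omega>)\<bar> \<le> K * ?l \<omega>" if "\<omega> \<in> space M" for \<omega>
    using g measurable_space[OF A' that] measurable_space[OF B' that]
    by (auto simp: lipschitz_ineq_def)
  show gL: "(\<lambda>\<omega>. g (A \<omega>) - g (B \<omega>)) \<in> Lp M p"
    by (rule Lp_bound[OF pa(1) _ Lp_cmult[OF l, of K]])
      (use le K in \<open>auto simp: abs_mult lnorm_nonneg\<close>)
  have "(\<integral>\<omega>. \<bar>g (A \<omega>) - g (B \<omega>)\<bar> powr p \<partial>M) \<le> (\<integral>\<omega>. K powr p * ?l \<omega> powr p \<partial>M)"
  proof (rule integral_mono)
    show "integrable M (\<lambda>\<omega>. \<bar>g (A \<omega>) - g (B \<omega>)\<bar> powr p)" using gL by (simp add: Lp_def)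
    show "integrable M (\<lambda>\<omega>. K powr p * ?l \<omega> powr p)" using l by (simp add: Lp_def lnorm_nonneg)
    show "\<bar>g (A \<omega>) - g (B \<omega>)\<bar> powr p \<le> K powr p * ?l \<omega> powr p" if "\<omega> \<in> space M" for \<omega>
      using le[OF that] pa(1) K powr_mono2[of p "\<bar>g (A \<omega>) - g (B \<omega>)\<bar>" "K * ?l \<omega>"]
      by (simp add: powr_mult)
  qed
  then have "(\<integral>\<omega>. \<bar>g (A \<omega>) - g (B \<omega>)\<bar> powr p \<partial>M) powr (1 / p)
      \<le> (K powr p * (\<integral>\<omega>. ?l \<omega> powr p \<partial>M)) powr (1 / p)"
    using pa(1) by (intro powr_mono2) auto
  also have "\<dots> = K * (\<integral>\<omega>. ?l \<omega> powr p \<partial>M) powr (1 / p)"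
    using pa(1) K by (simp add: powr_mult powr_powr)
  finally show "(\<integral>\<omega>. \<bar>g (A \<omega>) - g (B \<omega>)\<bar> powr p \<partial>M) powr (1 / p)
      \<le> K * (\<integral>\<omega>. ?l \<omega> powr p \<partial>M) powr (1 / p)" .
qed

text \<open>Applying \<open>g\<close> to both halves of a coupling of \<open>Y\<close> and
  \<open>X\<close> yields a coupling of g(Y) and g(X). Attainment of the multivariate infimum is not
  assumed, so the argument takes couplings that are optimal up to a small error.\<close>

lemma lipschitz_image_in_uncertainty:
  assumes pa: "1 \<le> p" "1 \<le> a" and g: "lipschitz_ineq a n g K"
    and X: "X \<in> Lp_vec M a p n" and gX: "(\<lambda>\<omega>. g (X \<omega>)) \<in> Lp M p"
    and Y: "Y \<in> uncertainty_vec M a p n \<epsilon> X"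
  shows "(\<lambda>\<omega>. g (Y \<omega>)) \<in> uncertainty M p (K * \<epsilon>) (\<lambda>\<omega>. g (X \<omega>))"
proof -
  have Y': "Y \<in> Lp_vec M a p n"
    and W: "wasserstein_vec M a p n (cdf_vec M n Y) (cdf_vec M n X) \<le> \<epsilon>"
    using Y by (auto simp: uncertainty_vec_def)
  have [measurable]: "X \<in> M \<rightarrow>\<^sub>M borel_Rn n" "Y \<in> M \<rightarrow>\<^sub>M borel_Rn n"
    using X Y' by (simp_all add: Lp_vec_def)
  have K: "0 \<le> K" using g by (simp add: lipschitz_ineq_def)
  have g_meas [measurable]: "g \<in> borel_measurable (borel_Rn n)"
    by (rule lipschitz_measurable[OF pa(2) g])
  have gY: "(\<lambda>\<omega>. g (Y \<omega>)) \<in> Lp M p"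
    using Lp_add[OF pa(1) lipschitz_diff_in_Lp(2)[OF pa g Y' X] gX] by simp
  let ?w = "wasserstein M p (cdf (distr M borel (\<lambda>\<omega>. g (Y \<omega>)))) (cdf (distr M borel (\<lambda>\<omega>. g (X \<omega>))))"
  have "?w \<le> K * \<epsilon> + e" if e: "0 < e" for e
  proof -
    \<comment> \<open>Adding 1 in the denominator covers K = 0 and still leaves
      \<open>K * \<delta>\<close> at most \<open>e\<close>.\<close>
    define \<delta> where "\<delta> = e / (K + 1)"
    have \<delta>: "0 < \<delta>" "K * \<delta> \<le> e" using e K by (auto simp: \<delta>_def field_simps)
    let ?C = "{(\<integral>\<omega>. lnorm (ereal a) n (\<lambda>i. A \<omega> i - B \<omega> i) powr p \<partial>M) powr (1 / p) | A B.
        A \<in> M \<rightarrow>\<^sub>M borel_Rn n \<and> B \<in> M \<rightarrow>\<^sub>M borel_Rn n \<and>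
        cdf_vec M n A = cdf_vec M n Y \<and> cdf_vec M n B = cdf_vec M n X}"
    have ne: "?C \<noteq> {}"
      using \<open>X \<in> M \<rightarrow>\<^sub>M borel_Rn n\<close> \<open>Y \<in> M \<rightarrow>\<^sub>M borel_Rn n\<close> by blast
    have lt: "Inf ?C < \<epsilon> + \<delta>"
      using W \<delta> unfolding wasserstein_vec_def by linarith
    obtain c where "c \<in> ?C" "c < \<epsilon> + \<delta>"
      using cInf_lessD[OF ne lt] by (rule bexE)
    then obtain A B where AB [measurable]: "A \<in> M \<rightarrow>\<^sub>M borel_Rn n" "B \<in> M \<rightarrow>\<^sub>M borel_Rn n"
      and eq: "cdf_vec M n A = cdf_vec M n Y" "cdf_vec M n B = cdf_vec M n X"
      and c: "(\<integral>\<omega>. lnorm (ereal a) n (\<lambda>i. A \<omega> i - B \<omega> i) powr p \<partial>M) powr (1 / p) < \<epsilon> + \<delta>"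
      by blast
    have "?w \<le> (\<integral>\<omega>. \<bar>g (A \<omega>) - g (B \<omega>)\<bar> powr p \<partial>M) powr (1 / p)"
      by (rule wasserstein_le) (simp_all add: cdf_distr_compose_eq[OF _ _ eq(1)] cdf_distr_compose_eq[OF _ _ eq(2)])
    also have "\<dots> \<le> K * (\<integral>\<omega>. lnorm (ereal a) n (\<lambda>i. A \<omega> i - B \<omega> i) powr p \<partial>M) powr (1 / p)"
      by (rule lipschitz_diff_in_Lp(3)[OF pa g Lp_vec_cong_cdf_vec[OF pa _ Y' eq(1)] Lp_vec_cong_cdf_vec[OF pa _ X eq(2)]])
        measurable
    also have "\<dots> \<le> K * (\<epsilon> + \<delta>)"
      using c K by (intro mult_left_mono) auto
    also have "\<dots> \<le> K * \<epsilon> + e" using \<delta> by (simp add: distrib_left)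
    finally show ?thesis .
  qed
  then have "?w \<le> K * \<epsilon>" by (rule field_le_epsilon)
  then show ?thesis using gY by (simp add: uncertainty_def)
qed

text \<open>
  Moving \<open>X\<close> by a multiple of the dual vector \<open>d\<close> in the linear coordinates changes \<open>g(X)\<close> into any
  prescribed variable \<open>Y'\<close> at the cost \<open>\<bar>Y' - g(X)\<bar> / \<parallel>\<beta>\<parallel>\<^sub>b\<close>, so that an optimal coupling of \<open>Y\<close>
  with \<open>g(X)\<close> itself lifts to a coupling with \<open>X\<close>.
\<close>

lemma exists_lift_in_uncertainty_vec:
  fixes V Y :: "'a \<Rightarrow> real"
  assumes pa: "1 \<le> p" "1 \<le> a" and b: "1 \<le> b" "1 / ereal a + 1 / b = 1" and \<epsilon>: "0 \<le> \<epsilon>"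
    and g: "lipschitz_ineq a n g K" and dec: "linear_decomposition n m g gt \<beta>"
    and X: "X \<in> Lp_vec M a p n" and gX: "(\<lambda>\<omega>. g (X \<omega>)) \<in> Lp M p"
    and V: "V \<in> borel_measurable M" "\<And>\<omega>. 0 \<le> V \<omega>" "\<And>\<omega>. V \<omega> \<le> 3/2"
      "\<And>u. prob {\<omega> \<in> space M. V \<omega> = u} = 0"
    and Y: "Y \<in> uncertainty M p (lnorm b (n - m) \<beta> * \<epsilon>) (\<lambda>\<omega>. g (X \<omega>))"
  obtains Z where "Z \<in> uncertainty_vec M a p n \<epsilon> X" "(\<lambda>\<omega>. g (Z \<omega>)) \<in> Lp M p"
    "distr M borel (\<lambda>\<omega>. g (Z \<omega>)) = distr M borel Y"
proof -
  define B where "B = lnorm b (n - m) \<beta>"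
  define T where "T \<omega> = g (X \<omega>)" for \<omega>
  have T: "T \<in> Lp M p" using gX by (simp add: T_def[abs_def])
  have YL: "Y \<in> Lp M p" and W: "wasserstein M p (cdf (distr M borel Y)) (cdf (distr M borel T)) \<le> B * \<epsilon>"
    using Y by (simp_all add: uncertainty_def B_def T_def[abs_def])
  obtain Y' where Y': "Y' \<in> Lp M p" and distr: "distr M borel Y' = distr M borel Y"
    and cost: "(\<integral>\<omega>. \<bar>Y' \<omega> - T \<omega>\<bar> powr p \<partial>M) powr (1 / p)
      \<le> wasserstein M p (cdf (distr M borel Y)) (cdf (distr M borel T))"
    by (rule wasserstein_attained[OF pa(1) T YL V]) blast
  have cost: "(\<integral>\<omega>. \<bar>Y' \<omega> - T \<omega>\<bar> powr p \<partial>M) powr (1 / p) \<le> B * \<epsilon>"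
    using cost W by simp
  have X_meas: "X \<in> M \<rightarrow>\<^sub>M borel_Rn n" using X by (simp add: Lp_vec_def)
  have [measurable]: "T \<in> borel_measurable M" "Y' \<in> borel_measurable M"
    using T Y' by (simp_all add: Lp_def)
  have B0: "0 \<le> B" by (simp add: B_def lnorm_nonneg)
  show thesis
  proof (cases "B = 0")
    case True
    \<comment> \<open>Here the univariate radius is 0, so the optimal coupling has cost 0 and
      \<open>Y'\<close> equals \<open>T\<close> almost surely. The vector \<open>X\<close> itself is
      then the lift.\<close>
    have int: "integrable M (\<lambda>\<omega>. \<bar>Y' \<omega> - T \<omega>\<bar> powr p)"
      using Lp_diff[OF pa(1) Y' T] by (simp add: Lp_def)
    have "(\<integral>\<omega>. \<bar>Y' \<omega> - T \<omega>\<bar> powr p \<partial>M) powr (1 / p) = 0"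
      using cost True by (simp add: antisym)
    then have "AE \<omega> in M. \<bar>Y' \<omega> - T \<omega>\<bar> powr p = 0"
      using integral_nonneg_eq_0_iff_AE[OF int] by simp
    then have "AE \<omega> in M. T \<omega> = Y' \<omega>" by eventually_elim simp
    then have "distr M borel T = distr M borel Y'"
      by (intro distr_cong_AE) auto
    moreover have "wasserstein_vec M a p n (cdf_vec M n X) (cdf_vec M n X) \<le> 0"
      using wasserstein_vec_le[OF X_meas X_meas, of a p] pa by (simp add: lnorm_def)
    ultimately show thesis
      using that[of X] X gX \<epsilon> distr by (simp add: uncertainty_vec_def T_def[abs_def])
  next
    case False
    then have B: "0 < B" using B0 by simp
    have m: "m \<le> n" and g_eq: "\<And>x. x \<in> Rn n \<Longrightarrow> g x = gt (restrict x {..<m}) + (\<Sum>i<n - m. \<beta> i * x (m + i))"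
      using dec by (auto simp: linear_decomposition_def)
    obtain d where d: "(\<Sum>i<n - m. \<beta> i * d i) = B" "lnorm (ereal a) (n - m) d = 1"
      using lnorm_dual_vector[OF pa(2) b, where n="n - m" and y=\<beta>] B unfolding B_def by blast
    define s where "s \<omega> = (Y' \<omega> - T \<omega>) / B" for \<omega>
    \<comment> \<open>The first block stays fixed, so the value of \<open>gt\<close> does not
      change, while the linear part grows by \<open>s\<close> times the pairing of
      \<open>\<beta>\<close> with \<open>d\<close>, that is by s * B = Y' - T.\<close>
    define Z where "Z \<omega> = (\<lambda>i\<in>{..<n}. X \<omega> i + s \<omega> * (if i < m then 0 else d (i - m)))" for \<omega>
    have sL: "s \<in> Lp M p"
      using Lp_cmult[OF Lp_diff[OF pa(1) Y' T], of "1 / B"] by (simp add: s_def[abs_def])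
    have Z_Lp: "(\<lambda>\<omega>. Z \<omega> i) \<in> Lp M p" if i: "i < n" for i
      using Lp_add[OF pa(1) _ Lp_cmult[OF sL, of "if i < m then 0 else d (i - m)"], of "\<lambda>\<omega>. X \<omega> i"]
        X i by (simp add: Z_def Lp_vec_iff[OF pa] mult.commute)
    have Z_meas: "Z \<in> M \<rightarrow>\<^sub>M borel_Rn n"
      unfolding borel_Rn_def
    proof (rule measurable_PiM_single')
      show "(\<lambda>\<omega>. Z \<omega> i) \<in> borel_measurable M" if "i \<in> {..<n}" for i
        using Z_Lp[of i] that by (simp add: Lp_def)
      show "Z \<in> space M \<rightarrow> {..<n} \<rightarrow>\<^sub>E space borel" by (auto simp: Z_def)
    qed
    have Z: "Z \<in> Lp_vec M a p n" using Z_meas Z_Lp by (simp add: Lp_vec_iff[OF pa])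
    have gZ: "g (Z \<omega>) = Y' \<omega>" if \<omega>: "\<omega> \<in> space M" for \<omega>
    proof -
      have "Z \<omega> \<in> Rn n" "X \<omega> \<in> Rn n"
        using measurable_space[OF Z_meas \<omega>] measurable_space[OF X_meas \<omega>] by simp_all
      moreover have "restrict (Z \<omega>) {..<m} = restrict (X \<omega>) {..<m}"
        using m by (auto simp: Z_def fun_eq_iff)
      moreover have "(\<Sum>i<n - m. \<beta> i * Z \<omega> (m + i)) = (\<Sum>i<n - m. \<beta> i * X \<omega> (m + i)) + s \<omega> * B"
      proof -
        have "(\<Sum>i<n - m. \<beta> i * Z \<omega> (m + i)) = (\<Sum>i<n - m. \<beta> i * X \<omega> (m + i) + s \<omega> * (\<beta> i * d i))"
          by (rule sum.cong) (auto simp: Z_def less_diff_conv add.commute algebra_simps)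
        then show ?thesis by (simp add: sum.distrib d(1) flip: sum_distrib_left)
      qed
      ultimately have "g (Z \<omega>) = T \<omega> + s \<omega> * B" by (simp add: g_eq T_def)
      then show ?thesis using B by (simp add: s_def)
    qed
    have "lnorm (ereal a) n (\<lambda>i. Z \<omega> i - X \<omega> i) = \<bar>s \<omega>\<bar>" for \<omega>
    proof -
      have "lnorm (ereal a) n (\<lambda>i. Z \<omega> i - X \<omega> i)
          = lnorm (ereal a) n (\<lambda>i. s \<omega> * (if i < m then 0 else d (i - m)))"
        by (rule lnorm_cong) (simp add: Z_def)
      also have "\<dots> = \<bar>s \<omega>\<bar>"
        using pa(2) by (simp add: lnorm_cmult lnorm_zero_extension[OF m] d(2))
      finally show ?thesis .
    qed
    then have "wasserstein_vec M a p n (cdf_vec M n Z) (cdf_vec M n X)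
        \<le> (\<integral>\<omega>. \<bar>s \<omega>\<bar> powr p \<partial>M) powr (1 / p)"
      using wasserstein_vec_le[OF Z_meas X_meas, of a p] by simp
    also have "\<dots> = (\<integral>\<omega>. \<bar>Y' \<omega> - T \<omega>\<bar> powr p \<partial>M) powr (1 / p) / B"
      using B pa(1) by (simp add: s_def abs_divide powr_divide powr_powr)
    also have "\<dots> \<le> \<epsilon>"
      using cost B by (simp add: field_simps)
    finally have "Z \<in> uncertainty_vec M a p n \<epsilon> X"
      using Z by (simp add: uncertainty_vec_def)
    moreover have meas: "(\<lambda>\<omega>. g (Z \<omega>)) \<in> borel_measurable M"
      using Z_meas lipschitz_measurable[OF pa(2) g] by (rule measurable_compose)
    moreover have "distr M borel (\<lambda>\<omega>. g (Z \<omega>)) = distr M borel Y"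
      unfolding distr[symmetric] by (intro distr_cong) (simp_all add: gZ)
    ultimately show thesis using that[of Z] Lp_cong_distr[OF meas YL] by blast
  qed
qed

end

section \<open>The two inequalities between the suprema and the equality cases\<close>

theorem proposition2:
  fixes M :: "(nat \<Rightarrow> real) measure"
    and n m :: nat
    and p a K L \<epsilon> :: real
    and b :: ereal
    and g gt :: "(nat \<Rightarrow> real) \<Rightarrow> real"
    and \<beta> :: "nat \<Rightarrow> real"
    and X :: "(nat \<Rightarrow> real) \<Rightarrow> nat \<Rightarrow> real"
    and \<rho> :: "((nat \<Rightarrow> real) \<Rightarrow> real) \<Rightarrow> real"
  assumes "prob_space M" and "sets M = sets (borel_Rn n)" and "nonatomic M"
    and "1 \<le> p"
    and "1 \<le> a" and "1 \<le> b" and "1 / ereal a + 1 / b = 1"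
    and nonconstant: "\<not> (\<exists>c. \<forall>x\<in>Rn n. g x = c)"
    and "is_lipschitz_constant a n g K"
    and "linear_decomposition n m g gt \<beta>"
    and smallest_m: "\<And>m' gt' \<beta>'. linear_decomposition n m' g gt' \<beta>' \<Longrightarrow> m \<le> m'"
    and "is_lipschitz_constant a m gt L"
    and "X \<in> Lp_vec M a p n" and "(\<lambda>\<omega>. g (X \<omega>)) \<in> Lp M p"
    and "0 \<le> \<epsilon>"
    and "law_invariant M p \<rho>"
  shows "(SUP Y\<in>uncertainty M p (lnorm b (n - m) \<beta> * \<epsilon>) (\<lambda>\<omega>. g (X \<omega>)). ereal (\<rho> Y))
           \<le> (SUP Y\<in>uncertainty_vec M a p n \<epsilon> X. ereal (\<rho> (\<lambda>\<omega>. g (Y \<omega>)))) \<and>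
         (SUP Y\<in>uncertainty_vec M a p n \<epsilon> X. ereal (\<rho> (\<lambda>\<omega>. g (Y \<omega>))))
           \<le> (SUP Y\<in>uncertainty M p (K * \<epsilon>) (\<lambda>\<omega>. g (X \<omega>)). ereal (\<rho> Y)) \<and>
         ((a = 1 \<and> L \<le> lnorm \<infinity> (n - m) \<beta>) \<or> m = 0 \<longrightarrow>
           (SUP Y\<in>uncertainty M p (lnorm b (n - m) \<beta> * \<epsilon>) (\<lambda>\<omega>. g (X \<omega>)). ereal (\<rho> Y))
             = (SUP Y\<in>uncertainty_vec M a p n \<epsilon> X. ereal (\<rho> (\<lambda>\<omega>. g (Y \<omega>)))) \<and>
           (SUP Y\<in>uncertainty_vec M a p n \<epsilon> X. ereal (\<rho> (\<lambda>\<omega>. g (Y \<omega>))))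
             = (SUP Y\<in>uncertainty M p (K * \<epsilon>) (\<lambda>\<omega>. g (X \<omega>)). ereal (\<rho> Y)))"
    (is "?low \<le> ?mid \<and> ?mid \<le> ?up \<and> (?cond \<longrightarrow> ?low = ?mid \<and> ?mid = ?up)")
proof -
  interpret prob_space M by fact
  have g: "lipschitz_ineq a n g K"
    using assms(9) by (simp add: is_lipschitz_constant_def)
  obtain V :: "(nat \<Rightarrow> real) \<Rightarrow> real" where V: "V \<in> borel_measurable M" "\<And>\<omega>. 0 \<le> V \<omega>" "\<And>\<omega>. V \<omega> \<le> 3/2"
      "\<And>u. prob {\<omega> \<in> space M. V \<omega> = u} = 0"
    by (rule nonatomic_imp_atomless_variable[OF assms(1-3)]) blast
  \<comment> \<open>Each \<open>Y\<close> in the smaller univariate set shares its law with some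
    g(Z), and law invariance makes the two values of \<rho> equal.\<close>
  have low: "?low \<le> ?mid"
  proof (rule SUP_mono)
    fix Y assume Y: "Y \<in> uncertainty M p (lnorm b (n - m) \<beta> * \<epsilon>) (\<lambda>\<omega>. g (X \<omega>))"
    obtain Z where Z: "Z \<in> uncertainty_vec M a p n \<epsilon> X" "(\<lambda>\<omega>. g (Z \<omega>)) \<in> Lp M p"
        "distr M borel (\<lambda>\<omega>. g (Z \<omega>)) = distr M borel Y"
      by (rule exists_lift_in_uncertainty_vec[OF assms(4-7) assms(15) g assms(10,13,14) V Y]) blast
    have "Y \<in> Lp M p" using Y by (simp add: uncertainty_def)
    then have "\<rho> (\<lambda>\<omega>. g (Z \<omega>)) = \<rho> Y"
      using assms(16) Z unfolding law_invariant_def by blast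
    then show "\<exists>Z\<in>uncertainty_vec M a p n \<epsilon> X. ereal (\<rho> Y) \<le> ereal (\<rho> (\<lambda>\<omega>. g (Z \<omega>)))"
      using Z(1) by (intro bexI[of _ Z]) simp_all
  qed
  have up: "?mid \<le> ?up"
    using lipschitz_image_in_uncertainty[OF assms(4,5) g assms(13,14)] by (intro SUP_mono) blast
  \<comment> \<open>This closes the cycle of inequalities: K is at most the dual norm, so the upper
    uncertainty set lies inside the lower one.\<close>
  have "?up \<le> ?low" if ?cond
  proof (rule SUP_subset_mono)
    have "K \<le> lnorm b (n - m) \<beta>"
      using lipschitz_constant_le_dual_norm[OF assms(5-7,9,10,12) that] .
    then show "uncertainty M p (K * \<epsilon>) (\<lambda>\<omega>. g (X \<omega>))
        \<subseteq> uncertainty M p (lnorm b (n - m) \<beta> * \<epsilon>) (\<lambda>\<omega>. g (X \<omega>))"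
      using assms(15) by (intro uncertainty_mono mult_right_mono)
  qed simp
  then show ?thesis using low up by (auto intro: antisym order_trans)
qed

end
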